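(* Let $n\ge 1$ and $1\le k\le n-1$, and put $v=n-k+1$. Then $v$ is a coking of the induced subgraph $T_n^k[[v]]$, and applying the coking elimination operation w.r.t. $v$ to $(T_n^k[[v]],\psi_n^k|_{[v]})$ yields exactly $(T_n^{k+1}[[v]],\psi_n^{k+1}|_{[v]})$; moreover the vertices $v+1,\dots,n$ are isolated in both $T_n^k$ and $T_n^{k+1}$, with $\psi_n^k(i)=\psi_n^{k+1}(i)$ for $i>v$. (Thus, via the affine equivalences $\mathcal{A}_{n+1}^{k+1}\cong\mathcal{A}(T_n^k,\psi_n^k)\times\Phi_1$, the sequence $\mathcal{A}_{n+1}^2,\mathcal{A}_{n+1}^3,\dots,\mathcal{A}_{n+1}^{n+1}$ is obtained by successive coking elimination operations.) Consequently, for every $\ell\ge 2$ and $2\le k\le\ell$, $\chi_{\mathcal{A}_\ell^k}(t)=t(t-\ell)^{\ell-1}$.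
   Context: $[a,b]=\{n\in\mathbb{Z}:a\le n\le b\}$, $[n]=[1,n]$. $T_n^k$ is the digraph on $[n]$ with edge set $\{(i,j):1\le i<j\le n-k+1\}$, and $\psi_n^k(i)=[-\min\{n-i+1,k\},0]$. For $W\subseteq[n]$, $G[W]$ is the induced subgraph. A vertex $v$ of a digraph $G$ is a coking if $(u,v)\in E_G$ for every other vertex $u$. For a vertex-weighted digraph $(G,\psi)$ with $\psi(i)=[a_i,b_i]$, the coking elimination operation w.r.t. a coking $v$ produces $(G',\psi')$ with $E_{G'}=E_G\setminus\{(i,v)\}$, $\psi'(i)=[a_i-1,b_i]$ for $i\ne v$, $\psi'(v)=\psi(v)$. $\mathcal{A}(G,\psi)$ is the arrangement of $x_i-x_j=0$ ($i<j$), $x_i-x_j=1$ ($(i,j)\in E_G$), $x_i=c$ ($c\in\psi(i)$); $\Phi_1$ is the empty arrangement in $\mathbb{R}$; products of arrangements are taken in the direct sum of the ambient spaces. For $2\le k\le\ell$, $\mathcal{A}_\ell^k$ is the arrangement in $\mathbb{R}^\ell$ of $x_i-x_j=0$ ($1\le i<j\le\ell$), $x_1-x_j=i$ ($1\le i<j\le\ell$, $i<k$), $x_i-x_j=1$ ($k\le i<j\le\ell$). $\chi$ denotes the characteristic polynomial $\sum_{X\in L(\mathcal{A})}\mu(X)t^{\dim X}$. *)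

theory Defs
  imports
    "HOL-Library.Function_Algebras"
    "HOL-Library.FuncSet"
    "HOL-Computational_Algebra.Polynomial"
    "Graph_Theory.Graph_Theory"
begin

section \<open>Vertex-weighted digraphs\<close>

definition pair_induce_subgraph :: "'a pair_pre_digraph \<Rightarrow> 'a set \<Rightarrow> 'a pair_pre_digraph" where
  "pair_induce_subgraph G W =
     \<lparr>pverts = W, parcs = {e \<in> parcs G. fst e \<in> W \<and> snd e \<in> W}\<rparr>"

lemma with_proj_pair_induce_subgraph:
  "with_proj (pair_induce_subgraph G W) = induce_subgraph (with_proj G) W"
  by (simp add: with_proj_def pair_induce_subgraph_def induce_subgraph_def)

definition coking :: "'a pair_pre_digraph \<Rightarrow> 'a \<Rightarrow> bool" where
  "coking G v \<longleftrightarrow> v \<in> pverts G \<and> (\<forall>u \<in> pverts G - {v}. (u, v) \<in> parcs G)"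

definition isolated_vertex :: "'a pair_pre_digraph \<Rightarrow> 'a \<Rightarrow> bool" where
  "isolated_vertex G v \<longleftrightarrow>
     v \<in> pverts G \<and> (\<forall>u. (u, v) \<notin> parcs G \<and> (v, u) \<notin> parcs G)"

text \<open>The weight \<open>[a, b]\<close> of a vertex is stored as the pair \<open>(a, b)\<close> of its end points.\<close>

type_synonym 'a weighted_digraph = "'a pair_pre_digraph \<times> ('a \<Rightarrow> int \<times> int)"

definition weighted_induce :: "'a weighted_digraph \<Rightarrow> 'a set \<Rightarrow> 'a weighted_digraph" where
  "weighted_induce D W = (pair_induce_subgraph (fst D) W, restrict (snd D) W)"

definition coking_elimination :: "'a \<Rightarrow> 'a weighted_digraph \<Rightarrow> 'a weighted_digraph" where
  "coking_elimination v D =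
     (\<lparr>pverts = pverts (fst D), parcs = parcs (fst D) - {(i, v) | i. True}\<rparr>,
      \<lambda>i \<in> pverts (fst D). if i = v then snd D v else (fst (snd D i) - 1, snd (snd D i)))"

text \<open>
  A coking elimination performed on an induced subgraph \<open>D[W]\<close>, all vertices outside \<open>W\<close>
  being isolated and keeping their weights.
\<close>

definition coking_elimination_step :: "'a weighted_digraph \<Rightarrow> 'a weighted_digraph \<Rightarrow> bool" where
  "coking_elimination_step D D' \<longleftrightarrow>
     pverts (fst D') = pverts (fst D) \<and>
     (\<exists>W v. W \<subseteq> pverts (fst D) \<and>
        coking (fst (weighted_induce D W)) v \<and>
        coking_elimination v (weighted_induce D W) = weighted_induce D' W \<and>
        (\<forall>i \<in> pverts (fst D) - W.
           isolated_vertex (fst D) i \<and> isolated_vertex (fst D') i \<and> snd D i = snd D' i))"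

definition T_digraph :: "nat \<Rightarrow> nat \<Rightarrow> nat pair_pre_digraph" where
  "T_digraph n k = \<lparr>pverts = {1..n}, parcs = {(i, j). 1 \<le> i \<and> i < j \<and> j \<le> n - k + 1}\<rparr>"

definition T_weight :: "nat \<Rightarrow> nat \<Rightarrow> nat \<Rightarrow> int \<times> int" where
  "T_weight n k i = (- min (int n - int i + 1) (int k), 0)"


section \<open>Hyperplane arrangements\<close>

text \<open>
  The space of real vectors indexed by a finite set \<open>I\<close> is realised as the functions
  vanishing outside \<open>I\<close>.
\<close>

definition coord_space :: "'i set \<Rightarrow> ('i \<Rightarrow> real) set" where
  "coord_space I = {x. \<forall>i. i \<notin> I \<longrightarrow> x i = 0}"

definition fun_scale :: "real \<Rightarrow> ('i \<Rightarrow> real) \<Rightarrow> 'i \<Rightarrow> real" where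
  "fun_scale c x = (\<lambda>i. c * x i)"

lemma vector_space_fun_scale: "vector_space fun_scale"
  by unfold_locales (auto simp: fun_scale_def fun_eq_iff algebra_simps)

definition flat_dim :: "('i \<Rightarrow> real) set \<Rightarrow> nat" where
  "flat_dim X = vector_space.dim fun_scale {x - y | x y. x \<in> X \<and> y \<in> X}"

record 'i arrangement =
  index_set :: "'i set"
  hyperplanes :: "('i \<Rightarrow> real) set set"

abbreviation ambient :: "'i arrangement \<Rightarrow> ('i \<Rightarrow> real) set" where
  "ambient A \<equiv> coord_space (index_set A)"

definition intersection_poset :: "'i arrangement \<Rightarrow> ('i \<Rightarrow> real) set set" where
  "intersection_poset A = {ambient A \<inter> \<Inter>B | B. B \<subseteq> hyperplanes A} - {{}}"

text \<open>
  The values \<open>\<mu>(X) = \<mu>(V, X)\<close> of the Moebius function of the intersection poset, ordered by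
  reverse inclusion with least element the ambient space \<open>V\<close>. The value 0 for an infinite
  poset is a dummy that makes the recursion terminate.
\<close>

function moebius :: "'i arrangement \<Rightarrow> ('i \<Rightarrow> real) set \<Rightarrow> int" where
  "moebius A X =
     (if \<not> finite (intersection_poset A) then 0
      else if X = ambient A then 1
      else - (\<Sum>Y \<in> {Y \<in> intersection_poset A. X \<subset> Y}. moebius A Y))"
  by auto

termination
proof (relation "measure (\<lambda>(A, X). card {Y \<in> intersection_poset A. X \<subset> Y})")
  fix A :: "'i arrangement" and X Y :: "('i \<Rightarrow> real) set"
  assume "\<not> infinite (intersection_poset A)" "Y \<in> {Y \<in> intersection_poset A. X \<subset> Y}"
  then show "((A, Y), A, X) \<in> measure (\<lambda>(A, X). card {Y \<in> intersection_poset A. X \<subset> Y})"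
    by (auto intro!: psubset_card_mono)
qed simp

declare moebius.simps [simp del]

definition char_poly_arr :: "'i arrangement \<Rightarrow> int poly" where
  "char_poly_arr A = (\<Sum>X \<in> intersection_poset A. monom (moebius A X) (flat_dim X))"

definition direct_sum_set ::
  "('i \<Rightarrow> real) set \<Rightarrow> ('j \<Rightarrow> real) set \<Rightarrow> ('i + 'j \<Rightarrow> real) set" where
  "direct_sum_set X Y = {case_sum x y | x y. x \<in> X \<and> y \<in> Y}"

definition arr_prod :: "'i arrangement \<Rightarrow> 'j arrangement \<Rightarrow> ('i + 'j) arrangement" where
  "arr_prod A B =
     \<lparr>index_set = index_set A <+> index_set B,
      hyperplanes = {direct_sum_set H (ambient B) | H. H \<in> hyperplanes A} \<union>
                    {direct_sum_set (ambient A) K | K. K \<in> hyperplanes B}\<rparr>"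

definition affine_map_on :: "('i \<Rightarrow> real) set \<Rightarrow> (('i \<Rightarrow> real) \<Rightarrow> 'j \<Rightarrow> real) \<Rightarrow> bool" where
  "affine_map_on S f \<longleftrightarrow>
     (\<forall>x \<in> S. \<forall>y \<in> S. \<forall>s t. s + t = 1 \<longrightarrow>
        f (fun_scale s x + fun_scale t y) = fun_scale s (f x) + fun_scale t (f y))"

definition affinely_equivalent :: "'i arrangement \<Rightarrow> 'j arrangement \<Rightarrow> bool" where
  "affinely_equivalent A B \<longleftrightarrow>
     (\<exists>f. bij_betw f (ambient A) (ambient B) \<and> affine_map_on (ambient A) f \<and>
          (\<lambda>H. f ` H) ` hyperplanes A = hyperplanes B)"

definition diff_hyperplane :: "'i set \<Rightarrow> 'i \<Rightarrow> 'i \<Rightarrow> real \<Rightarrow> ('i \<Rightarrow> real) set" where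
  "diff_hyperplane I i j c = {x \<in> coord_space I. x i - x j = c}"

definition coord_hyperplane :: "'i set \<Rightarrow> 'i \<Rightarrow> real \<Rightarrow> ('i \<Rightarrow> real) set" where
  "coord_hyperplane I i c = {x \<in> coord_space I. x i = c}"

definition digraph_arrangement :: "nat weighted_digraph \<Rightarrow> nat arrangement" where
  "digraph_arrangement D = (let V = pverts (fst D) in
     \<lparr>index_set = V,
      hyperplanes =
        {diff_hyperplane V i j 0 | i j. i \<in> V \<and> j \<in> V \<and> i < j} \<union>
        {diff_hyperplane V i j 1 | i j. (i, j) \<in> parcs (fst D)} \<union>
        {coord_hyperplane V i (real_of_int c) | i c.
           i \<in> V \<and> c \<in> {fst (snd D i)..snd (snd D i)}}\<rparr>)"

definition Phi1 :: "unit arrangement" where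
  "Phi1 = \<lparr>index_set = {()}, hyperplanes = {}\<rparr>"

definition shi_ish :: "nat \<Rightarrow> nat \<Rightarrow> nat arrangement" where
  "shi_ish l k = (let I = {1..l} in
     \<lparr>index_set = I,
      hyperplanes =
        {diff_hyperplane I i j 0 | i j. 1 \<le> i \<and> i < j \<and> j \<le> l} \<union>
        {diff_hyperplane I 1 j (real i) | i j. 1 \<le> i \<and> i < j \<and> j \<le> l \<and> i < k} \<union>
        {diff_hyperplane I i j 1 | i j. k \<le> i \<and> i < j \<and> j \<le> l}\<rparr>)"

end

theory Submission
  imports Defs
begin

text \<open>
  The characteristic polynomial is found by counting modulo large integers \<open>q\<close>. For an arrangement
  of hyperplanes \<open>x\<^sub>i - x\<^sub>j = c\<close> with integral \<open>c\<close>, a vector modulo \<open>q\<close> leaves a gap on the circle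
  that is wider than all the \<open>c\<close>; cutting the circle there yields an integral vector on
  exactly the same hyperplanes. Hence every vector modulo \<open>q\<close> determines a flat, a flat \<open>X\<close> contains
  \<open>q\<close> to the power \<open>dim X\<close> vectors modulo \<open>q\<close>, and Moebius inversion shows that \<open>\<chi>(q)\<close> counts the vectors on
  no hyperplane. For \<open>shi_ish l k\<close> normalise \<open>x\<^sub>1 = 0\<close>, which accounts for a factor \<open>q\<close>. The coordinates
  \<open>k, \<dots>, l\<close> are then counted by successively deleting the largest label together with its cell, and
  the coordinates \<open>k - 1, \<dots>, 2\<close> are placed greedily, each of them having \<open>q - l\<close> admissible positions.
\<close>

section \<open>Characteristic polynomials by counting points\<close>

lemma finite_intersection_poset:
  assumes "finite (hyperplanes A)"
  shows "finite (intersection_poset A)"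
proof -
  have "intersection_poset A \<subseteq> (\<lambda>B. ambient A \<inter> \<Inter>B) ` Pow (hyperplanes A)"
    unfolding intersection_poset_def by auto
  then show ?thesis
    using assms by (meson finite_Pow_iff finite_imageI finite_subset)
qed

lemma intersection_poset_subset_ambient: "X \<in> intersection_poset A \<Longrightarrow> X \<subseteq> ambient A"
  unfolding intersection_poset_def by auto

lemma ambient_in_intersection_poset: "ambient A \<in> intersection_poset A"
proof -
  have "(\<lambda>_. 0) \<in> ambient A" by (simp add: coord_space_def)
  then show ?thesis unfolding intersection_poset_def by (auto intro!: exI[of _ "{}"])
qed

lemma sum_moebius_above:
  assumes fin: "finite (intersection_poset A)" and Y: "Y \<in> intersection_poset A"
  shows "(\<Sum>X \<in> {X \<in> intersection_poset A. Y \<subseteq> X}. moebius A X) = (if Y = ambient A then 1 else 0)"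
proof (cases "Y = ambient A")
  case True
  have "{X \<in> intersection_poset A. Y \<subseteq> X} = {ambient A}"
    using True intersection_poset_subset_ambient ambient_in_intersection_poset by blast
  then show ?thesis using True fin by (simp add: moebius.simps)
next
  case False
  have "{X \<in> intersection_poset A. Y \<subseteq> X} = insert Y {X \<in> intersection_poset A. Y \<subset> X}"
    using Y by auto
  then have "(\<Sum>X \<in> {X \<in> intersection_poset A. Y \<subseteq> X}. moebius A X)
      = moebius A Y + (\<Sum>X \<in> {X \<in> intersection_poset A. Y \<subset> X}. moebius A X)"
    using fin by simp
  then show ?thesis using False fin by (simp add: moebius.simps[of A Y])
qed

text \<open>Once \<open>q ^ flat_dim X\<close> is replaced by a count of points and the two sums are
  exchanged, each point \<open>x\<close> contributes the sum of \<open>moebius\<close> over the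
  flats containing \<open>\<phi> x\<close>, which vanishes unless \<open>\<phi> x\<close> is the
  whole space.\<close>

lemma poly_char_poly_arr_eq_card:
  assumes fin: "finite (intersection_poset A)" and "finite P"
    and flat: "\<And>x. x \<in> P \<Longrightarrow> \<phi> x \<in> intersection_poset A"
    and count: "\<And>X. X \<in> intersection_poset A \<Longrightarrow> card {x \<in> P. \<phi> x \<subseteq> X} = q ^ flat_dim X"
  shows "poly (char_poly_arr A) (int q) = int (card {x \<in> P. \<phi> x = ambient A})"
proof -
  let ?L = "intersection_poset A"
  have "poly (char_poly_arr A) (int q) = (\<Sum>X\<in>?L. moebius A X * int (card {x \<in> P. \<phi> x \<subseteq> X}))"
    unfolding char_poly_arr_def poly_sum
    by (intro sum.cong) (auto simp: poly_monom count)
  also have "\<dots> = (\<Sum>X\<in>?L. \<Sum>x\<in>P. if \<phi> x \<subseteq> X then moebius A X else 0)"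
    using \<open>finite P\<close> by (intro sum.cong) (auto simp: sum.inter_filter[symmetric])
  also have "\<dots> = (\<Sum>x\<in>P. \<Sum>X\<in>?L. if \<phi> x \<subseteq> X then moebius A X else 0)"
    by (rule sum.swap)
  also have "\<dots> = (\<Sum>x\<in>P. \<Sum>X\<in>{X \<in> ?L. \<phi> x \<subseteq> X}. moebius A X)"
    using fin by (simp add: sum.inter_filter)
  also have "\<dots> = (\<Sum>x\<in>P. if \<phi> x = ambient A then 1 else 0)"
    using fin flat by (intro sum.cong) (auto simp: sum_moebius_above)
  also have "\<dots> = int (card {x \<in> P. \<phi> x = ambient A})"
    using \<open>finite P\<close> by (simp add: sum.inter_filter[symmetric])
  finally show ?thesis .
qed

section \<open>Vectors constant on the classes of an equivalence relation\<close>

lemma sum_fun_apply: "(\<Sum>s\<in>S. f s) i = (\<Sum>s\<in>S. f s i)"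
  by (induction S rule: infinite_finite_induct) auto

text \<open>The indicator functions of the classes form a basis: their supports are disjoint, and
  the coefficients of a vector are its values on the classes.\<close>

lemma dim_constant_on_classes:
  assumes fin: "finite I" and eq: "equiv I r"
  shows "vector_space.dim fun_scale {x \<in> coord_space I. \<forall>(i, j) \<in> r. x i = x j} = card (I // r)"
    (is "vector_space.dim _ ?D = _")
proof -
  interpret vs: vector_space fun_scale by (rule vector_space_fun_scale)
  define g :: "'a set \<Rightarrow> 'a \<Rightarrow> real" where "g C = (\<lambda>i. of_bool (i \<in> C))" for C
  have inj: "inj_on g (I // r)"
    by (rule inj_onI) (simp add: g_def fun_eq_iff of_bool_eq_iff set_eq_iff)
  have finq: "finite (I // r)"
    using fin eq by (simp add: finite_quotient equiv_type)
  have disj: "C = C'" if "C \<in> I // r" "C' \<in> I // r" "i \<in> C" "i \<in> C'" for C C' i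
    using quotient_disj[OF eq that(1,2)] that by auto
  have eval: "(\<Sum>C\<in>I // r. u C * g C i) = u C0" if "C0 \<in> I // r" "i \<in> C0" for u :: "'a set \<Rightarrow> real" and C0 i
  proof -
    have "(\<Sum>C\<in>I // r. u C * g C i) = (\<Sum>C\<in>I // r. if C = C0 then u C else 0)"
      using that disj by (intro sum.cong) (auto simp: g_def)
    also have "\<dots> = u C0" using finq that by simp
    finally show ?thesis .
  qed
  have sym: "sym r" using eq by (simp add: equiv_def)
  show ?thesis
  proof (rule vs.dim_unique)
    show "g ` (I // r) \<subseteq> ?D"
    proof clarify
      fix C assume C: "C \<in> I // r"
      have "C \<subseteq> I" by (rule in_quotient_imp_subset[OF eq C])
      then have "g C \<in> coord_space I" by (auto simp: g_def coord_space_def)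
      moreover have "g C i = g C j" if "(i, j) \<in> r" for i j
      proof -
        have "i \<in> C \<longleftrightarrow> j \<in> C"
          using in_quotient_imp_closed[OF eq C _ that]
            in_quotient_imp_closed[OF eq C _ symD[OF sym that]] by blast
        then show ?thesis by (simp add: g_def)
      qed
      ultimately show "g C \<in> coord_space I \<and> (\<forall>(i, j) \<in> r. g C i = g C j)" by auto
    qed
    show "?D \<subseteq> vs.span (g ` (I // r))"
    proof
      fix x assume x: "x \<in> ?D"
      define u where "u C = x (SOME i. i \<in> C)" for C
      have "x = (\<Sum>C\<in>I // r. fun_scale (u C) (g C))"
      proof
        fix i
        show "x i = (\<Sum>C\<in>I // r. fun_scale (u C) (g C)) i"
        proof (cases "i \<in> I")
          case True
          have *: "r `` {i} \<in> I // r" "i \<in> r `` {i}"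
            using quotientI[OF True] equiv_class_self[OF eq True] by auto
          have "(i, SOME j. j \<in> r `` {i}) \<in> r"
            using someI[of "\<lambda>j. j \<in> r `` {i}", OF *(2)] by simp
          then have "u (r `` {i}) = x i" using x by (auto simp: u_def)
          then show ?thesis
            using eval[OF *, of u] by (simp add: sum_fun_apply fun_scale_def)
        next
          case False
          have "g C i = 0" if "C \<in> I // r" for C
            using in_quotient_imp_subset[OF eq that] False by (auto simp: g_def)
          then show ?thesis
            using False x by (simp add: sum_fun_apply fun_scale_def coord_space_def)
        qed
      qed
      also have "\<dots> \<in> vs.span (g ` (I // r))"
        by (intro vs.span_sum vs.span_scale vs.span_base) auto
      finally show "x \<in> vs.span (g ` (I // r))" .
    qed
    show "vs.independent (g ` (I // r))"
    proof (rule vs.independent_if_scalars_zero)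
      show "finite (g ` (I // r))" using finq by simp
      fix f v assume 0: "(\<Sum>v\<in>g ` (I // r). fun_scale (f v) v) = 0" and "v \<in> g ` (I // r)"
      then obtain C where C: "C \<in> I // r" "v = g C" by auto
      obtain i where i: "i \<in> C" using in_quotient_imp_non_empty[OF eq C(1)] by blast
      have "0 = (\<Sum>C\<in>I // r. fun_scale (f (g C)) (g C)) i"
        using 0 by (simp add: sum.reindex[OF inj])
      also have "\<dots> = f v"
        using eval[OF C(1) i, of "\<lambda>C. f (g C)"] C(2) by (simp add: sum_fun_apply fun_scale_def)
      finally show "f v = 0" by simp
    qed
    show "card (g ` (I // r)) = card (I // r)" by (rule card_image[OF inj])
  qed
qed

text \<open>Such a function amounts to a function on the quotient, recovered by evaluating at a
  chosen representative of each class.\<close>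

lemma card_constant_on_classes:
  assumes fin: "finite I" and eq: "equiv I r"
  shows "card {x \<in> I \<rightarrow>\<^sub>E Q. \<forall>(i, j) \<in> r. x i = x j} = card Q ^ card (I // r)"
proof -
  have cls: "r `` {i} \<in> I // r" "i \<in> r `` {i}" if "i \<in> I" for i
    using quotientI[OF that] equiv_class_self[OF eq that] by auto
  have sub: "C \<subseteq> I" "C \<noteq> {}" "(SOME j. j \<in> C) \<in> C" if "C \<in> I // r" for C
    using in_quotient_imp_subset[OF eq that] in_quotient_imp_non_empty[OF eq that]
    by (auto simp: some_in_eq)
  have "bij_betw (\<lambda>u. \<lambda>i\<in>I. u (r `` {i})) ((I // r) \<rightarrow>\<^sub>E Q)
          {x \<in> I \<rightarrow>\<^sub>E Q. \<forall>(i, j) \<in> r. x i = x j}"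
  proof (rule bij_betw_byWitness[where f' = "\<lambda>x. \<lambda>C\<in>I // r. x (SOME i. i \<in> C)"])
    show "\<forall>u\<in>(I // r) \<rightarrow>\<^sub>E Q. (\<lambda>C\<in>I // r. (\<lambda>i\<in>I. u (r `` {i})) (SOME i. i \<in> C)) = u"
    proof
      fix u assume u: "u \<in> (I // r) \<rightarrow>\<^sub>E Q"
      show "(\<lambda>C\<in>I // r. (\<lambda>i\<in>I. u (r `` {i})) (SOME i. i \<in> C)) = u"
      proof
        fix C
        show "(\<lambda>C\<in>I // r. (\<lambda>i\<in>I. u (r `` {i})) (SOME i. i \<in> C)) C = u C"
        proof (cases "C \<in> I // r")
          case True
          have "r `` {SOME i. i \<in> C} = C"
            using sub[OF True] cls quotient_disj[OF eq _ True] by blast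
          then show ?thesis using True sub[OF True] by auto
        next
          case False
          then show ?thesis using u by (auto simp: PiE_def extensional_def)
        qed
      qed
    qed
    show "\<forall>x\<in>{x \<in> I \<rightarrow>\<^sub>E Q. \<forall>(i, j) \<in> r. x i = x j}.
            (\<lambda>i\<in>I. (\<lambda>C\<in>I // r. x (SOME i. i \<in> C)) (r `` {i})) = x"
    proof
      fix x assume x: "x \<in> {x \<in> I \<rightarrow>\<^sub>E Q. \<forall>(i, j) \<in> r. x i = x j}"
      show "(\<lambda>i\<in>I. (\<lambda>C\<in>I // r. x (SOME i. i \<in> C)) (r `` {i})) = x"
      proof
        fix i
        show "(\<lambda>i\<in>I. (\<lambda>C\<in>I // r. x (SOME i. i \<in> C)) (r `` {i})) i = x i"
        proof (cases "i \<in> I")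
          case True
          have "(i, SOME j. j \<in> r `` {i}) \<in> r" using sub(3)[OF cls(1)[OF True]] by simp
          then have "x i = x (SOME j. j \<in> r `` {i})" using x by auto
          then show ?thesis using True cls[OF True] by simp
        next
          case False
          then show ?thesis using x by (auto simp: PiE_def extensional_def)
        qed
      qed
    qed
    show "(\<lambda>u. \<lambda>i\<in>I. u (r `` {i})) ` ((I // r) \<rightarrow>\<^sub>E Q)
            \<subseteq> {x \<in> I \<rightarrow>\<^sub>E Q. \<forall>(i, j) \<in> r. x i = x j}"
    proof clarify
      fix u assume u: "u \<in> (I // r) \<rightarrow>\<^sub>E Q"
      have "(\<lambda>i\<in>I. u (r `` {i})) \<in> I \<rightarrow>\<^sub>E Q" using u cls by (auto simp: PiE_iff)
      moreover have "(\<lambda>i\<in>I. u (r `` {i})) i = (\<lambda>i\<in>I. u (r `` {i})) j" if "(i, j) \<in> r" for i j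
        using that eq equiv_type[OF eq] equiv_class_eq[OF eq that] by auto
      ultimately show "(\<lambda>i\<in>I. u (r `` {i})) \<in> I \<rightarrow>\<^sub>E Q \<and>
          (\<forall>(i, j) \<in> r. (\<lambda>i\<in>I. u (r `` {i})) i = (\<lambda>i\<in>I. u (r `` {i})) j)" by auto
    qed
    show "(\<lambda>x. \<lambda>C\<in>I // r. x (SOME i. i \<in> C)) ` {x \<in> I \<rightarrow>\<^sub>E Q. \<forall>(i, j) \<in> r. x i = x j}
            \<subseteq> (I // r) \<rightarrow>\<^sub>E Q"
      using sub by (auto simp: PiE_iff subset_iff)
  qed
  then show ?thesis
    using fin eq by (simp add: bij_betw_same_card[symmetric] card_PiE finite_quotient equiv_type)
qed

section \<open>Systems of difference equations over the reals and modulo \<open>q\<close>\<close>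

text \<open>Integral right-hand sides let the same triples be read as real equations and as
  congruences modulo \<open>q\<close>.\<close>

definition gain_arrangement :: "'i set \<Rightarrow> ('i \<times> 'i \<times> int) set \<Rightarrow> 'i arrangement" where
  "gain_arrangement I E =
     \<lparr>index_set = I, hyperplanes = (\<lambda>(i, j, c). diff_hyperplane I i j (of_int c)) ` E\<rparr>"

lemma dvd_diff_mod_iff: "q dvd a mod q - b mod q - c \<longleftrightarrow> q dvd a - b - c" for q :: int
proof -
  have "a - b - c = (a mod q - b mod q - c) + q * (a div q - b div q)"
    by (simp add: right_diff_distrib minus_mod_eq_mult_div[symmetric])
  then show ?thesis by (simp only: dvd_add_left_iff[OF dvd_triv_left])
qed

text \<open>Differences of real solutions, and solutions modulo \<open>q\<close> shifted by a fixed
  integral solution, are both described by constancy on the classes of one equivalence relation.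
  Each class contributes one dimension and one factor \<open>q\<close>.\<close>

lemma card_difference_system_mod:
  fixes F :: "('i \<times> 'i \<times> int) set" and I :: "'i set"
  defines "X \<equiv> {x \<in> coord_space I. \<forall>(i, j, c) \<in> F. x i - x j = of_int c}"
  assumes "finite I" "0 < q" "X \<noteq> {}"
    and FI: "\<And>i j c. (i, j, c) \<in> F \<Longrightarrow> i \<in> I \<and> j \<in> I"
  shows "card {x \<in> I \<rightarrow>\<^sub>E {0..<int q}. \<forall>(i, j, c) \<in> F. int q dvd x i - x j - c} = q ^ flat_dim X"
proof -
  obtain r where r: "r \<in> X" using \<open>X \<noteq> {}\<close> by blast
  \<comment> \<open>Rounding down a real solution gives an integral one, because all right-hand
    sides are integers.\<close>
  define p where "p i = \<lfloor>r i\<rfloor>" for i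
  have p: "p i - p j = c" if "(i, j, c) \<in> F" for i j c
  proof -
    have "r i = r j + of_int c" using r that unfolding X_def by fastforce
    then show ?thesis by (simp add: p_def)
  qed
  define D where "D = {x \<in> coord_space I. \<forall>(i, j, c) \<in> F. x i = (x j :: real)}"
  \<comment> \<open>\<open>D\<close> is the direction space of \<open>X\<close>. Relating
    coordinates that agree on all of \<open>D\<close> gives an equivalence relation at once, without
    generating one from \<open>F\<close>.\<close>
  define R where "R = {(i, j). i \<in> I \<and> j \<in> I \<and> (\<forall>x \<in> D. x i = x j)}"
  have eq: "equiv I R"
    unfolding R_def by (intro equivI refl_onI symI transI) auto
  have FR: "(i, j) \<in> R" if "(i, j, c) \<in> F" for i j c
    using FI[OF that] that unfolding R_def D_def by fastforce
  have D_R: "D = {x \<in> coord_space I. \<forall>(i, j) \<in> R. x i = x j}"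
    using FR unfolding D_def R_def by fastforce
  have "{x - y |x y. x \<in> X \<and> y \<in> X} = D"
  proof
    show "{x - y |x y. x \<in> X \<and> y \<in> X} \<subseteq> D"
    proof clarify
      fix x y assume "x \<in> X" "y \<in> X"
      then have "x - y \<in> coord_space I" by (simp add: X_def coord_space_def)
      moreover have "(x - y) i = (x - y) j" if "(i, j, c) \<in> F" for i j c
      proof -
        have "x i - x j = of_int c" "y i - y j = of_int c"
          using \<open>x \<in> X\<close> \<open>y \<in> X\<close> that unfolding X_def by fastforce+
        then show ?thesis by simp
      qed
      ultimately show "x - y \<in> D" unfolding D_def by auto
    qed
    show "D \<subseteq> {x - y |x y. x \<in> X \<and> y \<in> X}"
    proof
      fix x assume x: "x \<in> D"
      have "r + x \<in> coord_space I" using x r by (simp add: X_def D_def coord_space_def)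
      moreover have "(r + x) i - (r + x) j = of_int c" if "(i, j, c) \<in> F" for i j c
      proof -
        have "r i - r j = of_int c" "x i = x j"
          using x r that unfolding X_def D_def by fastforce+
        then show ?thesis by simp
      qed
      ultimately have "r + x \<in> X" unfolding X_def by auto
      moreover have "x = (r + x) - r" by simp
      ultimately show "x \<in> {x - y |x y. x \<in> X \<and> y \<in> X}" using r by blast
    qed
  qed
  then have dim: "flat_dim X = card (I // R)"
    unfolding flat_dim_def D_R using dim_constant_on_classes[OF \<open>finite I\<close> eq] by simp
  let ?S = "{x \<in> I \<rightarrow>\<^sub>E {0..<int q}. \<forall>(i, j, c) \<in> F. int q dvd x i - x j - c}"
  let ?Z = "{z \<in> I \<rightarrow>\<^sub>E {0..<int q}. \<forall>(i, j) \<in> R. z i = z j}"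
  \<comment> \<open>Equality along the triples of \<open>F\<close> propagates to all of
    \<open>R\<close>, because \<open>z\<close>, extended by zero, is itself a real vector in
    \<open>D\<close>.\<close>
  have Z: "z \<in> ?Z" if z: "z \<in> I \<rightarrow>\<^sub>E {0..<int q}" and zF: "\<And>i j c. (i, j, c) \<in> F \<Longrightarrow> z i = z j" for z
  proof -
    have "(\<lambda>i. if i \<in> I then of_int (z i) else 0) \<in> D"
      using zF FI unfolding D_def coord_space_def by fastforce
    then have "z i = z j" if "(i, j) \<in> R" for i j
      using that unfolding R_def by fastforce
    then show ?thesis using z by auto
  qed
  have "bij_betw (\<lambda>x. \<lambda>i\<in>I. (x i - p i) mod int q) ?S ?Z"
  proof (rule bij_betw_byWitness[where f' = "\<lambda>z. \<lambda>i\<in>I. (z i + p i) mod int q"])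
    have *: "(\<lambda>i\<in>I. h (x i) i) = x" if "x \<in> I \<rightarrow>\<^sub>E {0..<int q}"
      "\<And>i. i \<in> I \<Longrightarrow> x i \<in> {0..<int q} \<Longrightarrow> h (x i) i = x i" for x h
      using that by (auto simp: fun_eq_iff PiE_iff extensional_def)
    have "(\<lambda>i\<in>I. ((\<lambda>i\<in>I. (x i - p i) mod int q) i + p i) mod int q) = x"
      if "x \<in> I \<rightarrow>\<^sub>E {0..<int q}" for x
      using *[OF that, of "\<lambda>y i. ((y - p i) mod int q + p i) mod int q"]
      by (simp add: mod_simps cong: restrict_cong)
    then show "\<forall>x\<in>?S. (\<lambda>i\<in>I. ((\<lambda>i\<in>I. (x i - p i) mod int q) i + p i) mod int q) = x" by simp
    have "(\<lambda>i\<in>I. ((\<lambda>i\<in>I. (x i + p i) mod int q) i - p i) mod int q) = x"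
      if "x \<in> I \<rightarrow>\<^sub>E {0..<int q}" for x
      using *[OF that, of "\<lambda>y i. ((y + p i) mod int q - p i) mod int q"]
      by (simp add: mod_simps cong: restrict_cong)
    then show "\<forall>x\<in>?Z. (\<lambda>i\<in>I. ((\<lambda>i\<in>I. (x i + p i) mod int q) i - p i) mod int q) = x" by simp
    show "(\<lambda>x. \<lambda>i\<in>I. (x i - p i) mod int q) ` ?S \<subseteq> ?Z"
    proof (rule image_subsetI)
      fix x assume x: "x \<in> ?S"
      show "(\<lambda>i\<in>I. (x i - p i) mod int q) \<in> ?Z"
      proof (rule Z)
        show "(\<lambda>i\<in>I. (x i - p i) mod int q) \<in> I \<rightarrow>\<^sub>E {0..<int q}" using \<open>0 < q\<close> by auto
        fix i j c assume F: "(i, j, c) \<in> F"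
        have "int q dvd x i - x j - c" using x F by auto
        moreover have "x i - x j - c = (x i - p i) - (x j - p j)" using p[OF F] by simp
        ultimately show "(\<lambda>i\<in>I. (x i - p i) mod int q) i = (\<lambda>i\<in>I. (x i - p i) mod int q) j"
          using FI[OF F] by (simp add: mod_eq_dvd_iff)
      qed
    qed
    show "(\<lambda>z. \<lambda>i\<in>I. (z i + p i) mod int q) ` ?Z \<subseteq> ?S"
    proof (rule image_subsetI)
      fix z assume z: "z \<in> ?Z"
      have "(\<lambda>i\<in>I. (z i + p i) mod int q) \<in> I \<rightarrow>\<^sub>E {0..<int q}" using \<open>0 < q\<close> by auto
      moreover have "int q dvd (\<lambda>i\<in>I. (z i + p i) mod int q) i - (\<lambda>i\<in>I. (z i + p i) mod int q) j - c"
        if F: "(i, j, c) \<in> F" for i j c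
      proof -
        have "z i = z j" using z FR[OF F] by auto
        then show ?thesis using FI[OF F] p[OF F] by (simp add: dvd_diff_mod_iff)
      qed
      ultimately show "(\<lambda>i\<in>I. (z i + p i) mod int q) \<in> ?S" by auto
    qed
  qed
  then have "card ?S = card ?Z" by (rule bij_betw_same_card)
  also have "\<dots> = q ^ card (I // R)"
    using card_constant_on_classes[OF \<open>finite I\<close> eq, of "{0..<int q}"] by simp
  finally show ?thesis by (simp add: dim)
qed

text \<open>Each coordinate rules out at most \<open>m + 1\<close> starting points \<open>a\<close>,
  namely those with \<open>x i\<close> among \<open>a, ..., a + m\<close> modulo \<open>q\<close>.
  Altogether these are fewer than \<open>q\<close> residues.\<close>

lemma exists_wide_gap_mod:
  fixes x :: "'i \<Rightarrow> int"
  assumes "finite I" "card I * (m + 1) < q"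
  shows "\<exists>a. \<forall>i \<in> I. int m < (x i - a) mod int q"
proof -
  let ?bad = "\<Union>i\<in>I. (\<lambda>d. (x i - d) mod int q) ` {0..int m}"
  have "card ?bad \<le> (\<Sum>i\<in>I. card ((\<lambda>d. (x i - d) mod int q) ` {0..int m}))"
    by (rule card_UN_le[OF \<open>finite I\<close>])
  also have "\<dots> \<le> (\<Sum>i\<in>I. m + 1)"
  proof (rule sum_mono)
    fix i
    have "card ((\<lambda>d. (x i - d) mod int q) ` {0..int m}) \<le> card {0..int m}"
      by (rule card_image_le) simp
    then show "card ((\<lambda>d. (x i - d) mod int q) ` {0..int m}) \<le> m + 1" by simp
  qed
  also have "\<dots> < q" using assms(2) by simp
  finally have less: "card ?bad < card {0..<int q}" by simp
  have "\<not> {0..<int q} \<subseteq> ?bad"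
  proof
    assume "{0..<int q} \<subseteq> ?bad"
    moreover have "finite ?bad" using \<open>finite I\<close> by simp
    ultimately show False using less card_mono by (metis not_less)
  qed
  then obtain a where a: "a \<in> {0..<int q}" "a \<notin> ?bad" by blast
  have "int m < (x i - a) mod int q" if "i \<in> I" for i
  proof (rule ccontr)
    assume "\<not> int m < (x i - a) mod int q"
    moreover have "0 \<le> (x i - a) mod int q" using assms(2) by simp
    moreover have "a = (x i - (x i - a) mod int q) mod int q"
      using a(1) by (simp add: mod_simps)
    ultimately have "a \<in> (\<lambda>d. (x i - d) mod int q) ` {0..int m}" by auto
    then show False using a(2) that by blast
  qed
  then show ?thesis by blast
qed

text \<open>Cutting the circle at a wide gap turns congruences with small right-hand sides into equations.\<close>

lemma exists_integral_lift:
  fixes x :: "'i \<Rightarrow> int"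
  assumes "finite I" "card I * (m + 1) < q"
  shows "\<exists>y :: 'i \<Rightarrow> int. \<forall>i \<in> I. \<forall>j \<in> I. \<forall>c. \<bar>c\<bar> \<le> int m \<longrightarrow>
           (int q dvd x i - x j - c \<longleftrightarrow> y i - y j = c)"
proof -
  obtain a where a: "\<And>i. i \<in> I \<Longrightarrow> int m < (x i - a) mod int q"
    using exists_wide_gap_mod[OF assms] by metis
  define y where "y i = (x i - a) mod int q" for i
  have "int q dvd x i - x j - c \<longleftrightarrow> y i - y j = c" if "i \<in> I" "j \<in> I" "\<bar>c\<bar> \<le> int m" for i j c
  proof -
    have *: "int q dvd x i - x j - c \<longleftrightarrow> int q dvd y i - y j - c"
      by (simp add: y_def dvd_diff_mod_iff)
    have "int m < y i" "int m < y j" "y i < int q" "y j < int q"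
      using a that assms(2) by (auto simp: y_def)
    \<comment> \<open>Both values lie between \<open>m + 1\<close> and \<open>q - 1\<close>, so
      their difference is at most \<open>q - m - 2\<close> in absolute value, which leaves room for
      \<open>c\<close>.\<close>
    then have "\<bar>y i - y j - c\<bar> < int q" using that by linarith
    then have "int q dvd y i - y j - c \<longleftrightarrow> y i - y j - c = 0"
      using zdvd_not_zless[of "\<bar>y i - y j - c\<bar>" "int q"] by fastforce
    then show ?thesis using * by simp
  qed
  then show ?thesis by blast
qed

text \<open>A vector modulo \<open>q\<close> is assigned the intersection of all hyperplanes whose
  congruences it satisfies. Integral lifts take the place of reduction modulo a prime, so only the
  size of \<open>q\<close> matters.\<close>

lemma poly_char_poly_gain_arrangement:
  assumes "finite I" "finite E" and q: "card I * (m + 1) < q"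
    and E: "\<And>i j c. (i, j, c) \<in> E \<Longrightarrow> i \<in> I \<and> j \<in> I \<and> i \<noteq> j \<and> \<bar>c\<bar> \<le> int m"
  shows "poly (char_poly_arr (gain_arrangement I E)) (int q) =
    int (card {x \<in> I \<rightarrow>\<^sub>E {0..<int q}. \<forall>(i, j, c) \<in> E. \<not> int q dvd x i - x j - c})"
proof -
  let ?A = "gain_arrangement I E"
  let ?H = "\<lambda>(i, j, c). diff_hyperplane I i j (of_int c)"
  let ?P = "I \<rightarrow>\<^sub>E {0..<int q}"
  define Ex where "Ex x = {(i, j, c) \<in> E. int q dvd x i - x j - c}" for x :: "'a \<Rightarrow> int"
  define \<phi> where "\<phi> x = coord_space I \<inter> \<Inter>(?H ` Ex x)" for x
  have amb: "ambient ?A = coord_space I" by (simp add: gain_arrangement_def)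
  \<comment> \<open>A real point on exactly the hyperplanes given by \<open>Ex x\<close> shows that
    \<open>\<phi> x\<close> is nonempty, and that any hyperplane of the arrangement containing
    \<open>\<phi> x\<close> comes from a triple in \<open>Ex x\<close>.\<close>
  have lift: "\<exists>y \<in> coord_space I. \<forall>(i, j, c) \<in> E. y i - y j = of_int c \<longleftrightarrow> (i, j, c) \<in> Ex x" for x
  proof -
    obtain y :: "'a \<Rightarrow> int" where y: "\<forall>i \<in> I. \<forall>j \<in> I. \<forall>c. \<bar>c\<bar> \<le> int m \<longrightarrow>
        (int q dvd x i - x j - c \<longleftrightarrow> y i - y j = c)"
      using exists_integral_lift[OF \<open>finite I\<close> q] by blast
    define z where "z i = (if i \<in> I then real_of_int (y i) else 0)" for i
    have "z i - z j = of_int c \<longleftrightarrow> (i, j, c) \<in> Ex x" if "(i, j, c) \<in> E" for i j c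
    proof -
      have "z i - z j = of_int (y i - y j)" using E[OF that] by (simp add: z_def)
      then have "z i - z j = of_int c \<longleftrightarrow> y i - y j = c" by (metis of_int_eq_iff)
      then show ?thesis using E[OF that] y that by (auto simp: Ex_def)
    qed
    moreover have "z \<in> coord_space I" by (simp add: z_def coord_space_def)
    ultimately show ?thesis by blast
  qed
  have "poly (char_poly_arr ?A) (int q) = int (card {x \<in> ?P. \<phi> x = ambient ?A})"
  proof (rule poly_char_poly_arr_eq_card)
    show "finite (intersection_poset ?A)"
      by (rule finite_intersection_poset) (simp add: gain_arrangement_def \<open>finite E\<close>)
    show "finite ?P" using \<open>finite I\<close> by (simp add: finite_PiE)
    fix x
    obtain y where y: "y \<in> coord_space I" "\<And>i j c. (i, j, c) \<in> E \<Longrightarrow> y i - y j = of_int c \<longleftrightarrow> (i, j, c) \<in> Ex x"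
      using lift[of x] by blast
    have "y \<in> \<phi> x"
      using y by (auto simp: \<phi>_def diff_hyperplane_def Ex_def)
    moreover have "?H ` Ex x \<subseteq> hyperplanes ?A"
      by (auto simp: gain_arrangement_def Ex_def)
    ultimately show "\<phi> x \<in> intersection_poset ?A"
      unfolding intersection_poset_def amb using \<phi>_def[of x] by blast
  next
    fix X assume X: "X \<in> intersection_poset ?A"
    then obtain B where B: "B \<subseteq> ?H ` E" "X = coord_space I \<inter> \<Inter>B" and "X \<noteq> {}"
      unfolding intersection_poset_def amb by (auto simp: gain_arrangement_def)
    obtain F where F: "F \<subseteq> E" "B = ?H ` F" using B(1) by (auto simp: subset_image_iff)
    have Xeq: "X = {x \<in> coord_space I. \<forall>(i, j, c) \<in> F. x i - x j = of_int c}"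
      unfolding B(2) F(2) by (auto simp: diff_hyperplane_def)
    have "\<phi> x \<subseteq> X \<longleftrightarrow> (\<forall>(i, j, c) \<in> F. int q dvd x i - x j - c)" for x
    proof
      assume sub: "\<phi> x \<subseteq> X"
      obtain y where y: "y \<in> coord_space I" "\<And>i j c. (i, j, c) \<in> E \<Longrightarrow> y i - y j = of_int c \<longleftrightarrow> (i, j, c) \<in> Ex x"
        using lift[of x] by blast
      have "y \<in> \<phi> x"
        using y by (auto simp: \<phi>_def diff_hyperplane_def Ex_def)
      then have "y \<in> X" using sub by blast
      then show "\<forall>(i, j, c) \<in> F. int q dvd x i - x j - c"
        using y(2) F(1) unfolding Xeq Ex_def by fastforce
    next
      assume "\<forall>(i, j, c) \<in> F. int q dvd x i - x j - c"
      then have "F \<subseteq> Ex x" using F(1) by (auto simp: Ex_def)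
      then show "\<phi> x \<subseteq> X" unfolding \<phi>_def B(2) F(2) by blast
    qed
    moreover have "card {x \<in> ?P. \<forall>(i, j, c) \<in> F. int q dvd x i - x j - c} = q ^ flat_dim X"
      unfolding Xeq
    proof (rule card_difference_system_mod)
      show "0 < q" using q by simp
      show "{x \<in> coord_space I. \<forall>(i, j, c) \<in> F. x i - x j = of_int c} \<noteq> {}"
        using \<open>X \<noteq> {}\<close> Xeq by simp
      show "i \<in> I \<and> j \<in> I" if "(i, j, c) \<in> F" for i j c
        using that F(1) E by blast
    qed (rule \<open>finite I\<close>)
    ultimately show "card {x \<in> ?P. \<phi> x \<subseteq> X} = q ^ flat_dim X" by simp
  qed
  moreover have "\<phi> x = ambient ?A \<longleftrightarrow> (\<forall>(i, j, c) \<in> E. \<not> int q dvd x i - x j - c)" for x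
  proof
    assume eq: "\<phi> x = ambient ?A"
    have False if e: "(i, j, c) \<in> E" "int q dvd x i - x j - c" for i j c
    proof -
      have "\<phi> x \<subseteq> diff_hyperplane I i j (of_int c)" using e by (auto simp: \<phi>_def Ex_def)
      \<comment> \<open>As \<open>i \<noteq> j\<close>, this point has coordinate difference
        \<open>c + 1\<close>, so it is an ambient point off the hyperplane.\<close>
      moreover have "(\<lambda>k. if k = i then real_of_int c + 1 else 0) \<in> coord_space I"
        using E[OF e(1)] by (auto simp: coord_space_def)
      ultimately have "(\<lambda>k. if k = i then real_of_int c + 1 else 0) \<in> diff_hyperplane I i j (of_int c)"
        using eq amb by blast
      then show False using E[OF e(1)] by (auto simp: diff_hyperplane_def)
    qed
    then show "\<forall>(i, j, c) \<in> E. \<not> int q dvd x i - x j - c" by blast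
  next
    assume "\<forall>(i, j, c) \<in> E. \<not> int q dvd x i - x j - c"
    then have "Ex x = {}" by (auto simp: Ex_def)
    then show "\<phi> x = ambient ?A" by (simp add: \<phi>_def amb)
  qed
  ultimately show ?thesis by simp
qed

section \<open>Counting labelings\<close>

text \<open>The values are cells in a row, and no label is directly followed by a smaller one. This
  is what the Shi hyperplanes demand once the circle is cut open.\<close>

definition shi_labelings :: "nat \<Rightarrow> nat \<Rightarrow> int \<Rightarrow> (nat \<Rightarrow> int) set" where
  "shi_labelings a b N =
     {y \<in> {a..<b} \<rightarrow>\<^sub>E {1..N}. inj_on y {a..<b} \<and>
        (\<forall>i \<in> {a..<b}. \<forall>j \<in> {a..<b}. i < j \<longrightarrow> y i \<noteq> y j + 1)}"

lemma finite_shi_labelings: "finite (shi_labelings a b N)"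
  by (rule finite_subset[of _ "{a..<b} \<rightarrow>\<^sub>E {1..N}"]) (auto simp: shi_labelings_def intro: finite_PiE)

text \<open>
  The cell following the one of the largest label is not occupied, so deleting that label together
  with its cell creates no forbidden adjacency; conversely the largest label, in a new cell, can be
  inserted in front of any empty cell or at the end.
\<close>

lemma bij_betw_shi_labelings_Suc:
  assumes "a \<le> b"
  shows "bij_betw (\<lambda>(z, p). \<lambda>i \<in> {a..<Suc b}. if i = b then p else if p \<le> z i then z i + 1 else z i)
    (SIGMA z:shi_labelings a b (N - 1). {1..N} - z ` {a..<b}) (shi_labelings a (Suc b) N)"
    (is "bij_betw ?f ?S ?T")
proof (rule bij_betw_byWitness
    [where f' = "\<lambda>y. (\<lambda>i \<in> {a..<b}. if y b < y i then y i - 1 else y i, y b)"])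
  let ?g = "\<lambda>y :: nat \<Rightarrow> int. (\<lambda>i \<in> {a..<b}. if y b < y i then y i - 1 else y i, y b)"
  show "\<forall>s \<in> ?S. ?g (?f s) = s"
    using assms by (auto simp: fun_eq_iff shi_labelings_def PiE_iff extensional_def)
  show "\<forall>y \<in> ?T. ?f (?g y) = y"
  proof
    fix y assume y: "y \<in> ?T"
    have ne: "y i \<noteq> y b" if "a \<le> i" "i < b" for i
      using y that assms inj_onD[of y "{a..<Suc b}" i b] by (auto simp: shi_labelings_def)
    have undef: "y i = undefined" if "i \<notin> {a..<Suc b}" for i
      using y that by (auto simp: shi_labelings_def PiE_iff extensional_def)
    have "?f (?g y) i = y i" for i
    proof (cases "i \<in> {a..<Suc b}")
      case True
      then show ?thesis using ne[of i] by (cases "i = b") auto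
    next
      case False
      then show ?thesis using undef[OF False] assms by auto
    qed
    then show "?f (?g y) = y" by (rule ext)
  qed
  have "?f (z, p) \<in> ?T"
    if z: "z \<in> shi_labelings a b (N - 1)" and p: "p \<in> {1..N}" "p \<notin> z ` {a..<b}" for z p
  proof -
    let ?y = "?f (z, p)"
    have zr: "1 \<le> z i" "z i \<le> N - 1" "z i \<noteq> p" if "a \<le> i" "i < b" for i
      using z p that by (auto simp: shi_labelings_def PiE_iff)
    have zinj: "z i \<noteq> z j" if "a \<le> i" "i < j" "j < b" for i j
      using z that inj_onD[of z "{a..<b}" i j] by (auto simp: shi_labelings_def)
    have zadj: "z i \<noteq> z j + 1" if "a \<le> i" "i < j" "j < b" for i j
      using z that by (auto simp: shi_labelings_def)
    have "?y \<in> {a..<Suc b} \<rightarrow>\<^sub>E {1..N}"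
      using zr p by (fastforce simp: PiE_iff)
    moreover have ne: "?y i \<noteq> ?y j" if "a \<le> i" "i < j" "j < Suc b" for i j
      using zinj[of i j] zr[of i] that by (cases "j = b") auto
    moreover have "inj_on ?y {a..<Suc b}"
      by (rule linorder_inj_onI) (use ne in auto)
    \<comment> \<open>For two old labels on opposite sides of the new cell, the equation would force
      \<open>z i = z j\<close>. For \<open>j = b\<close> it would give \<open>z i = p\<close>, but
      \<open>p\<close> was chosen outside the image of \<open>z\<close>.\<close>
    moreover have "?y i \<noteq> ?y j + 1" if "a \<le> i" "i < j" "j < Suc b" for i j
      using zinj[of i j] zadj[of i j] zr[of i] that by (cases "j = b") auto
    ultimately show ?thesis by (simp add: shi_labelings_def)
  qed
  then show "?f ` ?S \<subseteq> ?T" by blast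
  show "?g ` ?T \<subseteq> ?S"
  proof (rule image_subsetI)
    fix y assume y: "y \<in> ?T"
    let ?z = "\<lambda>i \<in> {a..<b}. if y b < y i then y i - 1 else y i"
    have yr: "1 \<le> y i" "y i \<le> N" if "a \<le> i" "i < Suc b" for i
      using y that by (auto simp: shi_labelings_def PiE_iff)
    have yinj: "y i \<noteq> y j" if "a \<le> i" "i < j" "j < Suc b" for i j
      using y that inj_onD[of y "{a..<Suc b}" i j] by (auto simp: shi_labelings_def)
    have yadj: "y i \<noteq> y j + 1" if "a \<le> i" "i < j" "j < Suc b" for i j
      using y that by (auto simp: shi_labelings_def)
    have "?z i \<in> {1..N - 1}" if "i \<in> {a..<b}" for i
      using yr[of i] yr[of b] yinj[of i b] that assms by auto
    then have "?z \<in> {a..<b} \<rightarrow>\<^sub>E {1..N - 1}" by (auto simp: PiE_iff)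
    moreover have ne: "?z i \<noteq> ?z j" if "a \<le> i" "i < j" "j < b" for i j
      using yinj[of i j] yinj[of i b] yinj[of j b] that by auto
    moreover have "inj_on ?z {a..<b}"
      by (rule linorder_inj_onI) (use ne in auto)
    \<comment> \<open>Deleting the cell \<open>y b\<close> could create an adjacency only if
      \<open>y i = y j + 2\<close> with \<open>y b\<close> in between; then \<open>i\<close> would
      directly follow the larger label \<open>b\<close>.\<close>
    moreover have "?z i \<noteq> ?z j + 1" if "a \<le> i" "i < j" "j < b" for i j
      using yadj[of i j] yadj[of i b] yinj[of i b] yinj[of j b] that by auto
    ultimately have "?z \<in> shi_labelings a b (N - 1)" by (simp add: shi_labelings_def)
    moreover have "y b \<noteq> ?z i" if "i \<in> {a..<b}" for i
      using yadj[of i b] yinj[of i b] that by auto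
    moreover have "y b \<in> {1..N}" using yr[of b] assms by auto
    ultimately show "?g y \<in> ?S" by blast
  qed
qed

lemma card_Sigma_const:
  assumes "finite A" "\<And>a. a \<in> A \<Longrightarrow> finite (B a)" "\<And>a. a \<in> A \<Longrightarrow> int (card (B a)) = c"
  shows "int (card (Sigma A B)) = int (card A) * c"
  using assms by (simp add: card_SigmaI)

text \<open>Of the \<open>N\<close> places for the last of \<open>m + 1\<close> labels,
  \<open>m\<close> are blocked. Removing that label with its cell lowers both the number of labels
  and the number of cells by one, so the base stays \<open>N - m\<close>.\<close>

lemma card_shi_labelings:
  "int m \<le> N \<Longrightarrow> int (card (shi_labelings a (a + m) N)) = (N - int m + 1) ^ m"
proof (induction m arbitrary: N)
  case 0
  show ?case by (simp add: shi_labelings_def)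
next
  case (Suc m)
  have "int (card ({1..N} - z ` {a..<a + m})) = N - int m" if z: "z \<in> shi_labelings a (a + m) (N - 1)" for z
  proof -
    have "z ` {a..<a + m} \<subseteq> {1..N}" "card (z ` {a..<a + m}) = m"
      using z by (auto simp: shi_labelings_def PiE_iff card_image)
    then show ?thesis using Suc.prems by (simp add: card_Diff_subset of_nat_diff)
  qed
  then have "int (card (SIGMA z:shi_labelings a (a + m) (N - 1). {1..N} - z ` {a..<a + m})) =
      int (card (shi_labelings a (a + m) (N - 1))) * (N - int m)"
    by (intro card_Sigma_const) (simp_all add: finite_shi_labelings)
  then have "int (card (shi_labelings a (a + Suc m) N)) =
      int (card (shi_labelings a (a + m) (N - 1))) * (N - int m)"
    using bij_betw_same_card[OF bij_betw_shi_labelings_Suc[of a "a + m" N]] by simp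
  also have "\<dots> = (N - int (Suc m) + 1) ^ Suc m"
    using Suc by simp
  finally show ?case .
qed

section \<open>Greedy placement of the labels below \<open>k\<close>\<close>

text \<open>With \<open>x 1 = 0\<close> modulo \<open>q\<close>, the hyperplanes through coordinate
  1 exclude for label \<open>j\<close> exactly the residue 0 and the last \<open>min j k - 1\<close>
  residues, hence the interval. The parameter \<open>a\<close> is the least label placed so far, for
  a descending induction.\<close>

definition shi_ish_labelings :: "nat \<Rightarrow> nat \<Rightarrow> int \<Rightarrow> nat \<Rightarrow> (nat \<Rightarrow> int) set" where
  "shi_ish_labelings l k q a =
     {y \<in> (\<Pi>\<^sub>E i \<in> {a..<Suc l}. {1..q - int (min i k)}). inj_on y {a..<Suc l} \<and>
        (\<forall>i \<in> {a..<Suc l}. \<forall>j \<in> {a..<Suc l}. k \<le> i \<and> i < j \<longrightarrow> y i \<noteq> y j + 1)}"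

lemma finite_shi_ish_labelings: "finite (shi_ish_labelings l k q a)"
  by (rule finite_subset[of _ "\<Pi>\<^sub>E i \<in> {a..<Suc l}. {1..q - int (min i k)}"])
    (auto simp: shi_ish_labelings_def intro: finite_PiE)

text \<open>The adjacency condition concerns only labels from \<open>k\<close> on, so a label
  \<open>a\<close> below \<open>k\<close> may take any free cell of its range.\<close>

lemma bij_betw_shi_ish_labelings:
  assumes "a < k" "k \<le> l"
  shows "bij_betw (\<lambda>(z, p). z(a := p))
    (SIGMA z:shi_ish_labelings l k q (Suc a). {1..q - int a} - z ` {Suc a..<Suc l})
    (shi_ish_labelings l k q a)" (is "bij_betw ?f ?S ?T")
proof (rule bij_betw_byWitness[where f' = "\<lambda>y. (y(a := undefined), y a)"])
  let ?g = "\<lambda>y :: nat \<Rightarrow> int. (y(a := undefined), y a)"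
  have ins: "{a..<Suc l} = insert a {Suc a..<Suc l}" using assms by auto
  show "\<forall>s \<in> ?S. ?g (?f s) = s"
    by (auto simp: fun_eq_iff shi_ish_labelings_def PiE_iff extensional_def)
  show "\<forall>y \<in> ?T. ?f (?g y) = y" by simp
  have "?f (z, p) \<in> ?T" if z: "z \<in> shi_ish_labelings l k q (Suc a)"
    and p: "p \<in> {1..q - int a}" "p \<notin> z ` {Suc a..<Suc l}" for z p
  proof -
    have "z(a := p) \<in> (\<Pi>\<^sub>E i \<in> {a..<Suc l}. {1..q - int (min i k)})"
      using z p assms unfolding ins by (auto simp: shi_ish_labelings_def PiE_iff extensional_def)
    moreover have "inj_on (z(a := p)) {a..<Suc l}"
    proof -
      have "inj_on z {Suc a..<Suc l}" using z by (simp add: shi_ish_labelings_def)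
      then have "inj_on (z(a := p)) {Suc a..<Suc l}" by (simp add: inj_on_def)
      moreover have "(z(a := p)) ` {Suc a..<Suc l} = z ` {Suc a..<Suc l}" by auto
      ultimately show ?thesis using p unfolding ins inj_on_insert by auto
    qed
    moreover have "(z(a := p)) i \<noteq> (z(a := p)) j + 1"
      if "i \<in> {a..<Suc l}" "j \<in> {a..<Suc l}" "k \<le> i" "i < j" for i j
      using z that assms by (auto simp: shi_ish_labelings_def)
    ultimately show ?thesis by (simp add: shi_ish_labelings_def)
  qed
  then show "?f ` ?S \<subseteq> ?T" by blast
  show "?g ` ?T \<subseteq> ?S"
  proof (rule image_subsetI)
    fix y assume y: "y \<in> ?T"
    have "y a \<in> {1..q - int (min a k)}"
      using y assms by (auto simp only: shi_ish_labelings_def PiE_iff mem_Collect_eq ins)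
    then have "y a \<in> {1..q - int a}" using assms by simp
    moreover have "y(a := undefined) \<in> shi_ish_labelings l k q (Suc a)"
      using y by (auto simp: shi_ish_labelings_def PiE_iff extensional_def inj_on_def)
    moreover have "y a \<notin> (y(a := undefined)) ` {Suc a..<Suc l}"
    proof -
      have "inj_on y (insert a {Suc a..<Suc l})" using y ins by (simp add: shi_ish_labelings_def)
      then have "y a \<notin> y ` {Suc a..<Suc l}" by (simp add: inj_on_insert)
      then show ?thesis by auto
    qed
    ultimately show "?g y \<in> ?S" by blast
  qed
qed

text \<open>The labels from \<open>k\<close> on share the range \<open>1, ..., q - k\<close>, and
  the Shi count has base \<open>q - l\<close>. The ranges grow as the labels decrease, so when
  \<open>n < k\<close> is placed, all \<open>l - n\<close> larger labels occupy cells of its range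
  \<open>1, ..., q - n\<close>; this leaves \<open>q - l\<close> cells whatever \<open>n\<close>
  is.\<close>

lemma card_shi_ish_labelings:
  assumes "a \<le> k" "k \<le> l" "int l < q"
  shows "int (card (shi_ish_labelings l k q a)) = (q - int l) ^ (Suc l - a)"
  using assms(1)
proof (induction rule: inc_induct)
  case base
  have "shi_ish_labelings l k q k = shi_labelings k (Suc l) (q - int k)"
    unfolding shi_ish_labelings_def shi_labelings_def by (intro Collect_cong) (auto simp: PiE_iff)
  also have "Suc l = k + (Suc l - k)" using assms by simp
  also have "int (card (shi_labelings k \<dots> (q - int k))) = (q - int l) ^ (Suc l - k)"
    using assms by (subst card_shi_labelings) (auto simp: of_nat_diff)
  finally show ?case .
next
  case (step n)
  have "int (card ({1..q - int n} - z ` {Suc n..<Suc l})) = q - int l"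
    if z: "z \<in> shi_ish_labelings l k q (Suc n)" for z
  proof -
    have "z i \<in> {1..q - int n}" if "i \<in> {Suc n..<Suc l}" for i
    proof -
      have "z i \<in> {1..q - int (min i k)}" using z that by (auto simp: shi_ish_labelings_def PiE_iff)
      moreover have "n \<le> min i k" using that step by simp
      ultimately show ?thesis by auto
    qed
    then have "z ` {Suc n..<Suc l} \<subseteq> {1..q - int n}" by blast
    moreover have "card (z ` {Suc n..<Suc l}) = l - n"
      using z by (simp add: shi_ish_labelings_def card_image)
    ultimately show ?thesis using assms step by (simp add: card_Diff_subset of_nat_diff)
  qed
  then have "int (card (SIGMA z:shi_ish_labelings l k q (Suc n). {1..q - int n} - z ` {Suc n..<Suc l})) =
      int (card (shi_ish_labelings l k q (Suc n))) * (q - int l)"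
    by (intro card_Sigma_const) (simp_all add: finite_shi_ish_labelings)
  then have "int (card (shi_ish_labelings l k q n)) =
      int (card (shi_ish_labelings l k q (Suc n))) * (q - int l)"
    using bij_betw_same_card[OF bij_betw_shi_ish_labelings[of n k l q]] step assms by simp
  also have "\<dots> = (q - int l) ^ Suc (Suc l - Suc n)"
    using step by simp
  also have "Suc (Suc l - Suc n) = Suc l - n" using step assms by simp
  finally show ?case .
qed

section \<open>Points modulo \<open>q\<close> off the hyperplanes of
  \<open>shi_ish l k\<close>\<close>

definition shi_ish_gains :: "nat \<Rightarrow> nat \<Rightarrow> (nat \<times> nat \<times> int) set" where
  "shi_ish_gains l k =
     {(i, j, 0) | i j. 1 \<le> i \<and> i < j \<and> j \<le> l} \<union>
     {(1, j, int i) | i j. 1 \<le> i \<and> i < j \<and> j \<le> l \<and> i < k} \<union>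
     {(i, j, 1) | i j. k \<le> i \<and> i < j \<and> j \<le> l}"

lemma shi_ish_eq_gain_arrangement: "shi_ish l k = gain_arrangement {1..l} (shi_ish_gains l k)"
proof -
  have "hyperplanes (shi_ish l k) = hyperplanes (gain_arrangement {1..l} (shi_ish_gains l k))"
    unfolding shi_ish_def gain_arrangement_def shi_ish_gains_def image_Un Let_def arrangement.simps
    by (intro arg_cong2[of _ _ _ _ "(\<union>)"]) (force simp: image_iff)+
  moreover have "index_set (shi_ish l k) = index_set (gain_arrangement {1..l} (shi_ish_gains l k))"
    by (simp add: shi_ish_def gain_arrangement_def Let_def)
  ultimately show ?thesis by simp
qed

text \<open>Triples with first index 1 restrict the range of a single \<open>y j\<close>; all others
  depend only on differences, which are unchanged when \<open>x 1\<close> is moved to 0. It remains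
  to pass from congruences to equations.\<close>

lemma avoids_shi_ish_gains_iff:
  fixes x y :: "nat \<Rightarrow> int"
  assumes "2 \<le> k" "k \<le> l" "int l \<le> q"
    and y: "y \<in> extensional {2..<Suc l}" "\<And>j. j \<in> {2..<Suc l} \<Longrightarrow> y j = (x j - x 1) mod q"
  shows "(\<forall>(i, j, c) \<in> shi_ish_gains l k. \<not> q dvd x i - x j - c) \<longleftrightarrow> y \<in> shi_ish_labelings l k q 2"
proof -
  have q: "0 < q" using assms by linarith
  have yr: "0 \<le> y j" "y j < q" if "j \<in> {2..<Suc l}" for j
    using y(2)[OF that] q by auto
  have small: "q dvd d \<longleftrightarrow> d = 0" if "\<bar>d\<bar> < q" for d
    using that zdvd_not_zless[of "\<bar>d\<bar>" q] by fastforce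
  have one: "q dvd x 1 - x j - c \<longleftrightarrow> y j = 0 \<and> c = 0 \<or> y j = q - c"
    if j: "j \<in> {2..<Suc l}" and c: "0 \<le> c" "c < q" for j c
  proof -
    have "q dvd x 1 - x j - c \<longleftrightarrow> q dvd x j - x 1 - 0 - (- c)"
      using dvd_minus_iff[of q "x 1 - x j - c"] by (simp add: algebra_simps)
    also have "\<dots> \<longleftrightarrow> q dvd y j + c"
      using dvd_diff_mod_iff[of q "x j - x 1" 0 "- c"] y(2)[OF j] by simp
    \<comment> \<open>The sum lies between 0 and \<open>2 * q - 2\<close>, so 0 and \<open>q\<close>
      are its only possible multiples of \<open>q\<close>.\<close>
    also have "q dvd y j + c \<longleftrightarrow> y j + c = 0 \<or> y j + c = q"
    proof
      assume dvd: "q dvd y j + c"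
      show "y j + c = 0 \<or> y j + c = q"
      proof (cases "y j + c < q")
        case True
        then show ?thesis using small[of "y j + c"] dvd yr[OF j] c by auto
      next
        case False
        then show ?thesis using small[of "y j + c - q"] dvd yr[OF j] c by auto
      qed
    qed auto
    finally show ?thesis using yr[OF j] c by auto
  qed
  have two: "q dvd x i - x j - c \<longleftrightarrow> q dvd y i - y j - c"
    if "i \<in> {2..<Suc l}" "j \<in> {2..<Suc l}" for i j c
  proof -
    have "x i - x j - c = (x i - x 1) - (x j - x 1) - c" by simp
    then show ?thesis using that by (simp only: y(2) dvd_diff_mod_iff)
  qed
  have range: "y j \<in> {1..q - int (min j k)} \<longleftrightarrow>
      \<not> q dvd x 1 - x j - 0 \<and> (\<forall>i. 1 \<le> i \<and> i < j \<and> i < k \<longrightarrow> \<not> q dvd x 1 - x j - int i)"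
    (is "?L \<longleftrightarrow> ?R") if j: "j \<in> {2..<Suc l}" for j
  proof
    assume L: ?L
    have "\<not> q dvd x 1 - x j - int i" if "i < j" "i < k" for i
    proof -
      have "int i < q" using that assms by linarith
      moreover have "int i < int (min j k)" using that by simp
      ultimately show ?thesis using one[OF j, of "int i"] L yr[OF j] by auto
    qed
    from this[of 0] this show ?R using assms j by auto
  next
    assume R: ?R
    have "y j \<noteq> 0" using R one[OF j, of 0] q by auto
    moreover have "y j \<le> q - int (min j k)"
    proof (rule ccontr)
      assume "\<not> y j \<le> q - int (min j k)"
      \<comment> \<open>A value above the bound lies on the hyperplane \<open>x 1 - x j = i\<close>
        with \<open>i = q - y j\<close>.\<close>
      then have "1 \<le> nat (q - y j) \<and> nat (q - y j) < j \<and> nat (q - y j) < k"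
        using yr[OF j] by auto
      then show False using R one[OF j, of "q - y j"] yr[OF j] \<open>y j \<noteq> 0\<close> by auto
    qed
    ultimately show ?L using yr[OF j] by auto
  qed
  show ?thesis
  proof
    assume av: "\<forall>(i, j, c) \<in> shi_ish_gains l k. \<not> q dvd x i - x j - c"
    have a0: "\<not> q dvd x i - x j - 0" if "1 \<le> i" "i < j" "j \<le> l" for i j
    proof -
      have "(i, j, 0) \<in> shi_ish_gains l k" using that by (auto simp: shi_ish_gains_def)
      then show ?thesis using av by fast
    qed
    have a1: "\<not> q dvd x 1 - x j - int i" if "1 \<le> i" "i < j" "j \<le> l" "i < k" for i j
    proof -
      have "(1, j, int i) \<in> shi_ish_gains l k" using that by (auto simp: shi_ish_gains_def)
      then show ?thesis using av by fast
    qed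
    have a2: "\<not> q dvd x i - x j - 1" if "k \<le> i" "i < j" "j \<le> l" for i j
    proof -
      have "(i, j, 1) \<in> shi_ish_gains l k" using that by (auto simp: shi_ish_gains_def)
      then show ?thesis using av by fast
    qed
    have "y j \<in> {1..q - int (min j k)}" if "j \<in> {2..<Suc l}" for j
      unfolding range[OF that] using that a0[of 1 j] a1[of _ j] by auto
    moreover have "inj_on y {2..<Suc l}"
    proof (rule linorder_inj_onI)
      fix i j assume "i < j" "i \<in> {2..<Suc l}" "j \<in> {2..<Suc l}"
      then show "y i \<noteq> y j" using two[of i j 0] a0[of i j] by auto
    qed auto
    moreover have "y i \<noteq> y j + 1" if "i \<in> {2..<Suc l}" "j \<in> {2..<Suc l}" "k \<le> i" "i < j" for i j
      using two[of i j 1] a2[of i j] that by auto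
    ultimately show "y \<in> shi_ish_labelings l k q 2"
      using y(1) by (simp add: shi_ish_labelings_def PiE_iff)
  next
    assume Y: "y \<in> shi_ish_labelings l k q 2"
    then have r: "y j \<in> {1..q - int (min j k)}" if "j \<in> {2..<Suc l}" for j
      using that by (auto simp: shi_ish_labelings_def PiE_iff)
    have inj: "y i \<noteq> y j" if "i \<in> {2..<Suc l}" "j \<in> {2..<Suc l}" "i < j" for i j
      using Y that inj_onD[of y "{2..<Suc l}" i j] by (auto simp: shi_ish_labelings_def)
    have "\<not> q dvd x i - x j - 0" if "1 \<le> i" "i < j" "j \<le> l" for i j
    proof (cases "i = 1")
      case True
      then show ?thesis using r[of j] range[of j] that by auto
    next
      case False
      have ij: "i \<in> {2..<Suc l}" "j \<in> {2..<Suc l}" using that False by auto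
      have "\<bar>y i - y j - 0\<bar> < q" using yr[OF ij(1)] yr[OF ij(2)] by auto
      then show ?thesis unfolding two[OF ij] using small inj[OF ij] that by auto
    qed
    moreover have "\<not> q dvd x 1 - x j - int i" if "1 \<le> i" "i < j" "j \<le> l" "i < k" for i j
      using r[of j] range[of j] that by auto
    moreover have "\<not> q dvd x i - x j - 1" if "k \<le> i" "i < j" "j \<le> l" for i j
    proof -
      have ij: "i \<in> {2..<Suc l}" "j \<in> {2..<Suc l}" using that assms by auto
      \<comment> \<open>Wrapping around would need \<open>y i = 0\<close> and
        \<open>y j = q - 1\<close>, but labels start at cell 1.\<close>
      have "\<bar>y i - y j - 1\<bar> < q" using r[OF ij(1)] r[OF ij(2)] that assms by auto
      moreover have "y i \<noteq> y j + 1" using Y ij that by (auto simp: shi_ish_labelings_def)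
      ultimately show ?thesis unfolding two[OF ij] using small by auto
    qed
    ultimately show "\<forall>(i, j, c) \<in> shi_ish_gains l k. \<not> q dvd x i - x j - c"
      unfolding shi_ish_gains_def by auto
  qed
qed

text \<open>The value of \<open>x 1\<close> is free and gives the factor \<open>q\<close>; the
  differences from it form a labeling.\<close>

lemma card_avoiding_shi_ish_gains:
  assumes "2 \<le> k" "k \<le> l" "l < q"
  shows "int (card {x \<in> {1..l} \<rightarrow>\<^sub>E {0..<int q}.
      \<forall>(i, j, c) \<in> shi_ish_gains l k. \<not> int q dvd x i - x j - c}) = int q * (int q - int l) ^ (l - 1)"
    (is "int (card ?X) = _")
proof -
  let ?Y = "shi_ish_labelings l k (int q) 2"
  let ?f = "\<lambda>x :: nat \<Rightarrow> int. (x 1, \<lambda>i\<in>{2..<Suc l}. (x i - x 1) mod int q)"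
  let ?g = "\<lambda>(s, y :: nat \<Rightarrow> int). \<lambda>i\<in>{1..l}. if i = 1 then s else (y i + s) mod int q"
  have ql: "0 < int q" "int l \<le> int q" using assms by auto
  have iff: "(\<forall>(i, j, c) \<in> shi_ish_gains l k. \<not> int q dvd x i - x j - c) \<longleftrightarrow> y \<in> ?Y"
    if "y = snd (?f x)" for x y
    using that by (intro avoids_shi_ish_gains_iff) (use assms in auto)
  have gf: "?g (?f x) = x" if "x \<in> {1..l} \<rightarrow>\<^sub>E {0..<int q}" for x
  proof
    fix i
    show "?g (?f x) i = x i"
    proof (cases "i \<in> {1..l}")
      case True
      then have "0 \<le> x i" "x i < int q" using that by (auto simp: PiE_iff)
      then show ?thesis using True by (auto simp: mod_simps)
    next
      case False
      then show ?thesis using that by (auto simp: PiE_iff extensional_def)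
    qed
  qed
  have fg: "?f (?g (s, y)) = (s, y)" if "s \<in> {0..<int q}" "y \<in> ?Y" for s y
  proof -
    have "(\<lambda>i\<in>{2..<Suc l}. (?g (s, y) i - ?g (s, y) 1) mod int q) i = y i" for i
    proof (cases "i \<in> {2..<Suc l}")
      case True
      then have "y i \<in> {1..int q - int (min i k)}" using that(2) by (auto simp: shi_ish_labelings_def PiE_iff)
      then have "0 \<le> y i" "y i < int q" using assms True by auto
      then show ?thesis using True by (simp add: mod_simps)
    next
      case False
      then show ?thesis using that(2) by (auto simp: shi_ish_labelings_def PiE_iff extensional_def)
    qed
    then show ?thesis using assms by (auto simp: fun_eq_iff)
  qed
  have "bij_betw ?f ?X ({0..<int q} \<times> ?Y)"
  proof (rule bij_betw_byWitness[where f' = ?g])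
    show "\<forall>x \<in> ?X. ?g (?f x) = x" using gf by blast
    show "\<forall>s \<in> {0..<int q} \<times> ?Y. ?f (?g s) = s" using fg by blast
    show "?f ` ?X \<subseteq> {0..<int q} \<times> ?Y"
    proof (rule image_subsetI)
      fix x assume x: "x \<in> ?X"
      then have "x 1 \<in> {0..<int q}" using assms by (auto simp: PiE_iff)
      then show "?f x \<in> {0..<int q} \<times> ?Y" using x iff[OF refl, of x] by simp
    qed
    have "?g (s, y) \<in> ?X" if s: "s \<in> {0..<int q}" and y: "y \<in> ?Y" for s y
    proof -
      have "?g (s, y) \<in> {1..l} \<rightarrow>\<^sub>E {0..<int q}" using s ql by auto
      moreover have "y = snd (?f (?g (s, y)))" by (simp only: fg[OF s y] snd_conv)
      ultimately show ?thesis using iff y by blast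
    qed
    then show "?g ` ({0..<int q} \<times> ?Y) \<subseteq> ?X" by blast
  qed
  then have "card ?X = card ({0..<int q} \<times> ?Y)" by (rule bij_betw_same_card)
  then have "int (card ?X) = int q * int (card ?Y)"
    by (simp add: card_cartesian_product)
  also have "int (card ?Y) = (int q - int l) ^ (Suc l - 2)"
    using assms by (intro card_shi_ish_labelings) auto
  also have "Suc l - 2 = l - 1" by simp
  finally show ?thesis .
qed

text \<open>All right-hand sides are at most \<open>l\<close>, so the counting formula applies with
  \<open>m = l\<close> to every \<open>q\<close> above \<open>l * (l + 1)\<close>. Polynomials that
  agree at infinitely many integers are equal.\<close>

lemma char_poly_shi_ish:
  assumes "2 \<le> k" "k \<le> l"
  shows "char_poly_arr (shi_ish l k) = [:0, 1:] * [:- int l, 1:] ^ (l - 1)" (is "?p = ?r")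
proof -
  have fin: "finite (shi_ish_gains l k)"
    by (rule finite_subset[of _ "{0..l} \<times> {0..l} \<times> {0..int l}"])
      (use assms in \<open>auto simp: shi_ish_gains_def\<close>)
  have eq: "poly ?p (int q) = poly ?r (int q)" if q: "l * (l + 1) < q" for q
  proof -
    have "l < q" using q by simp
    have "poly ?p (int q) = int (card {x \<in> {1..l} \<rightarrow>\<^sub>E {0..<int q}.
        \<forall>(i, j, c) \<in> shi_ish_gains l k. \<not> int q dvd x i - x j - c})"
      unfolding shi_ish_eq_gain_arrangement
      by (rule poly_char_poly_gain_arrangement[where m = l])
        (use q fin assms in \<open>auto simp: shi_ish_gains_def\<close>)
    also have "\<dots> = int q * (int q - int l) ^ (l - 1)"
      using assms \<open>l < q\<close> by (rule card_avoiding_shi_ish_gains)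
    also have "\<dots> = poly ?r (int q)" by (simp add: poly_power)
    finally show ?thesis .
  qed
  have "int ` {l * (l + 1)<..} \<subseteq> {x. poly (?p - ?r) x = 0}"
    using eq by auto
  moreover have "infinite (int ` {l * (l + 1)<..})"
    by (simp add: finite_image_iff infinite_Ioi)
  ultimately have "?p - ?r = 0"
    using poly_roots_finite finite_subset by blast
  then show ?thesis by simp
qed

section \<open>Affine equivalences and coking eliminations\<close>

text \<open>
  The vertex \<open>i\<close> of \<open>T_digraph n k\<close> stands for the difference \<open>x\<^sub>j - x\<^sub>1\<close>, \<open>j = shi_ish_index n k i\<close>.
  The vertices carrying arcs have equal weights, so they can be listed in the order that gives the
  arcs the required orientation; the others are listed in reverse order.
\<close>

definition shi_ish_index :: "nat \<Rightarrow> nat \<Rightarrow> nat \<Rightarrow> nat" where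
  "shi_ish_index n k i = (if i \<le> n - k + 1 then k + i else n + 2 - i)"

lemma bij_betw_shi_ish_index:
  assumes "1 \<le> k" "k \<le> n"
  shows "bij_betw (shi_ish_index n k) {1..n} {2..n + 1}"
  by (rule bij_betw_byWitness[where f' = "\<lambda>j. if k + 1 \<le> j then j - k else n + 2 - j"])
    (use assms in \<open>auto simp: shi_ish_index_def\<close>)

text \<open>For every vertex \<open>min (n - i + 1) k = min (\<sigma> i - 1) k\<close>, so the
  negated weights run through 0 and the right-hand sides allowed for coordinate
  \<open>\<sigma> i\<close>. The weight 0 stands for the hyperplane on which coordinates 1 and
  \<open>\<sigma> i\<close> agree.\<close>

lemma hyperplanes_shi_ish_index:
  assumes "1 \<le> k" "k \<le> n"
  defines "\<sigma> \<equiv> shi_ish_index n k" and "I \<equiv> {1..n + 1}"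
  shows "hyperplanes (shi_ish (n + 1) (k + 1)) =
    {diff_hyperplane I (\<sigma> i) (\<sigma> j) 0 | i j. i \<in> {1..n} \<and> j \<in> {1..n} \<and> i < j} \<union>
    {diff_hyperplane I (\<sigma> i) (\<sigma> j) 1 | i j. (i, j) \<in> parcs (T_digraph n k)} \<union>
    {diff_hyperplane I 1 (\<sigma> i) (- real_of_int c) | i c.
       i \<in> {1..n} \<and> c \<in> {fst (T_weight n k i)..snd (T_weight n k i)}}"
    (is "?L = ?R1 \<union> ?R2 \<union> ?R3")
proof
  have bij: "bij_betw \<sigma> {1..n} {2..n + 1}"
    unfolding \<sigma>_def by (rule bij_betw_shi_ish_index) fact+
  \<comment> \<open>\<open>\<sigma>\<close> is not monotone in general, so the hyperplanes with
    right-hand side 0 may appear with their indices exchanged.\<close>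
  have comm: "diff_hyperplane I a b 0 = diff_hyperplane I b a 0" for a b
    by (auto simp: diff_hyperplane_def)
  have R1: "diff_hyperplane I i j 0 \<in> ?R1" if "2 \<le> i" "i < j" "j \<le> n + 1" for i j
  proof -
    have "i \<in> \<sigma> ` {1..n}" "j \<in> \<sigma> ` {1..n}" using bij_betw_imp_surj_on[OF bij] that by auto
    then obtain a b where ab: "a \<in> {1..n}" "b \<in> {1..n}" "i = \<sigma> a" "j = \<sigma> b" by blast
    then have "a \<noteq> b" using that by auto
    then consider "a < b" | "b < a" by linarith
    then show ?thesis
    proof cases
      case 1
      then show ?thesis using ab by blast
    next
      case 2
      then show ?thesis using ab comm[of i j] by blast
    qed
  qed
  have R3: "diff_hyperplane I 1 j (real i) \<in> ?R3" if "2 \<le> j" "j \<le> n + 1" "i < j" "i \<le> k" for i j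
  proof -
    have "j \<in> \<sigma> ` {1..n}" using bij_betw_imp_surj_on[OF bij] that by simp
    then obtain b where b: "b \<in> {1..n}" "j = \<sigma> b" by blast
    have "- int i \<in> {fst (T_weight n k b)..snd (T_weight n k b)}"
      using b that assms(1,2) by (auto simp: T_weight_def \<sigma>_def shi_ish_index_def split: if_splits)
    moreover have "diff_hyperplane I 1 j (real i) = diff_hyperplane I 1 (\<sigma> b) (- real_of_int (- int i))"
      using b by simp
    ultimately show ?thesis using b(1) by blast
  qed
  have R2: "diff_hyperplane I i j 1 \<in> ?R2" if "k + 1 \<le> i" "i < j" "j \<le> n + 1" for i j
  proof -
    have "(i - k, j - k) \<in> parcs (T_digraph n k)" "\<sigma> (i - k) = i" "\<sigma> (j - k) = j"
      using that assms(1,2) by (auto simp: T_digraph_def \<sigma>_def shi_ish_index_def)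
    then show ?thesis by force
  qed
  have "diff_hyperplane I i j 0 \<in> ?R1 \<union> ?R3" if "1 \<le> i" "i < j" "j \<le> n + 1" for i j
  proof (cases "i = 1")
    case True
    then show ?thesis using R3[of j 0] that by auto
  next
    case False
    then show ?thesis using R1[of i j] that by auto
  qed
  moreover have "diff_hyperplane I 1 j (real i) \<in> ?R3" if "1 \<le> i" "i < j" "j \<le> n + 1" "i < k + 1" for i j
    using R3[of j i] that by simp
  ultimately show "?L \<subseteq> ?R1 \<union> ?R2 \<union> ?R3"
    using R2 unfolding shi_ish_def Let_def arrangement.simps I_def[symmetric] by blast
  have \<sigma>: "\<sigma> i \<in> {2..n + 1}" if "i \<in> {1..n}" for i
    using bij that by (rule bij_betw_apply)
  have L1: "diff_hyperplane I i j 0 \<in> ?L" if "1 \<le> i" "i < j" "j \<le> n + 1" for i j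
    using that unfolding shi_ish_def Let_def arrangement.simps I_def[symmetric] by blast
  have "?R1 \<subseteq> ?L"
  proof clarify
    fix i j assume ij: "i \<in> {1..n}" "j \<in> {1..n}" "i < j"
    then have "\<sigma> i \<noteq> \<sigma> j" using bij by (metis bij_betw_inv_into_left less_irrefl)
    then show "diff_hyperplane I (\<sigma> i) (\<sigma> j) 0 \<in> ?L"
      using L1[of "\<sigma> i" "\<sigma> j"] L1[of "\<sigma> j" "\<sigma> i"] comm[of "\<sigma> i" "\<sigma> j"] \<sigma>[OF ij(1)] \<sigma>[OF ij(2)]
      by (cases "\<sigma> i < \<sigma> j") auto
  qed
  moreover have "?R2 \<subseteq> ?L"
  proof clarify
    fix i j assume "(i, j) \<in> parcs (T_digraph n k)"
    then have "k + 1 \<le> \<sigma> i" "\<sigma> i < \<sigma> j" "\<sigma> j \<le> n + 1"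
      using assms(1,2) by (auto simp: T_digraph_def \<sigma>_def shi_ish_index_def)
    then show "diff_hyperplane I (\<sigma> i) (\<sigma> j) 1 \<in> ?L"
      unfolding shi_ish_def Let_def arrangement.simps I_def[symmetric] by blast
  qed
  moreover have "?R3 \<subseteq> ?L"
  proof clarify
    fix i c assume i: "i \<in> {1..n}" and c: "c \<in> {fst (T_weight n k i)..snd (T_weight n k i)}"
    define d where "d = nat (- c)"
    have d: "- real_of_int c = real d" "d < \<sigma> i" "d < k + 1"
      using c i assms(1,2) by (auto simp: d_def T_weight_def \<sigma>_def shi_ish_index_def)
    show "diff_hyperplane I 1 (\<sigma> i) (- real_of_int c) \<in> ?L"
    proof (cases "d = 0")
      case True
      then show ?thesis using L1[of 1 "\<sigma> i"] \<sigma>[OF i] d by simp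
    next
      case False
      then have "1 \<le> d" by simp
      then show ?thesis
        using \<sigma>[OF i] d(2,3) unfolding d(1) shi_ish_def Let_def arrangement.simps I_def[symmetric]
        by fastforce
    qed
  qed
  ultimately show "?R1 \<union> ?R2 \<union> ?R3 \<subseteq> ?L" by (intro Un_least)
qed

lemma image_Collect2_cong:
  assumes "\<And>i j. R i j \<Longrightarrow> F (h i j) = G (h' i j)"
  shows "F ` {h i j | i j. R i j} = G ` {h' i j | i j. R i j}"
  using assms by (auto simp: image_iff) metis+

text \<open>The hyperplanes of \<open>shi_ish\<close> are invariant under adding a constant to all
  coordinates. Taking differences from \<open>x 1\<close> splits off this direction;
  \<open>x 1\<close> itself becomes the coordinate of the factor \<open>Phi1\<close>.\<close>

lemma affinely_equivalent_shi_ish: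
  assumes "1 \<le> k" "k \<le> n"
  shows "affinely_equivalent (shi_ish (n + 1) (k + 1))
    (arr_prod (digraph_arrangement (T_digraph n k, T_weight n k)) Phi1)"
proof -
  define \<sigma> where "\<sigma> = shi_ish_index n k"
  define \<tau> where "\<tau> = inv_into {1..n} \<sigma>"
  let ?V = "{1..n}" and ?I = "{1..n + 1}"
  have bij: "bij_betw \<sigma> ?V {2..n + 1}"
    unfolding \<sigma>_def by (rule bij_betw_shi_ish_index) fact+
  have \<sigma>: "\<sigma> i \<in> {2..n + 1}" "\<tau> (\<sigma> i) = i" if "i \<in> ?V" for i
    using bij_betw_apply[OF bij that] bij_betw_inv_into_left[OF bij that] by (auto simp: \<tau>_def)
  have \<tau>: "\<tau> j \<in> ?V" "\<sigma> (\<tau> j) = j" if "j \<in> {2..n + 1}" for j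
    using bij_betw_apply[OF bij_betw_inv_into[OF bij] that] bij_betw_inv_into_right[OF bij that]
    by (auto simp: \<tau>_def)
  define f :: "(nat \<Rightarrow> real) \<Rightarrow> nat + unit \<Rightarrow> real" where
    "f x = case_sum (\<lambda>i. if i \<in> ?V then x (\<sigma> i) - x 1 else 0) (\<lambda>_. x 1)" for x
  define g :: "(nat + unit \<Rightarrow> real) \<Rightarrow> nat \<Rightarrow> real" where
    "g y = (\<lambda>j. if j = 1 then y (Inr ()) else if j \<in> {2..n + 1} then y (Inl (\<tau> j)) + y (Inr ()) else 0)" for y
  let ?W = "coord_space (?V <+> {()}) :: (nat + unit \<Rightarrow> real) set"
  have gI: "g y \<in> coord_space ?I" for y by (auto simp: g_def coord_space_def)
  have fW: "f x \<in> ?W" for x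
    by (auto simp: f_def coord_space_def split: sum.splits)
  have gf: "g (f x) = x" if "x \<in> coord_space ?I" for x
    using that \<tau> by (auto simp: fun_eq_iff f_def g_def coord_space_def)
  have fg: "f (g y) = y" if "y \<in> ?W" for y
  proof
    fix s
    show "f (g y) s = y s"
    proof (cases s)
      case (Inl i)
      show ?thesis
      proof (cases "i \<in> ?V")
        case True
        then show ?thesis using \<sigma>[OF True] Inl by (auto simp: f_def g_def)
      next
        case False
        then have "Inl i \<notin> ?V <+> {()}" by auto
        then have "y (Inl i) = 0" using that unfolding coord_space_def by blast
        then show ?thesis using Inl False by (auto simp: f_def)
      qed
    qed (simp add: f_def g_def)
  qed
  \<comment> \<open>A condition that depends only on the differences is carried to a product with
    the full line.\<close>
  have img: "f ` {x \<in> coord_space ?I. P x} = direct_sum_set {y \<in> coord_space ?V. Q y} (coord_space {()})"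
    if PQ: "\<And>x. P x \<longleftrightarrow> Q (\<lambda>i. f x (Inl i))" for P Q
  proof
    show "f ` {x \<in> coord_space ?I. P x} \<subseteq> direct_sum_set {y \<in> coord_space ?V. Q y} (coord_space {()})"
    proof clarify
      fix x assume "P x"
      have "f x = case_sum (\<lambda>i. f x (Inl i)) (\<lambda>i. f x (Inr i))" by (auto simp: fun_eq_iff split: sum.splits)
      moreover have "(\<lambda>i. f x (Inl i)) \<in> coord_space ?V" by (auto simp: coord_space_def f_def)
      moreover have "(\<lambda>i. f x (Inr i)) \<in> coord_space {()}" by (simp add: coord_space_def)
      ultimately show "f x \<in> direct_sum_set {y \<in> coord_space ?V. Q y} (coord_space {()})"
        using \<open>P x\<close> PQ unfolding direct_sum_set_def by blast
    qed
    show "direct_sum_set {y \<in> coord_space ?V. Q y} (coord_space {()}) \<subseteq> f ` {x \<in> coord_space ?I. P x}"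
    proof
      fix w assume "w \<in> direct_sum_set {y \<in> coord_space ?V. Q y} (coord_space {()})"
      then obtain y z where w: "w = case_sum y z" "y \<in> coord_space ?V" "Q y"
        by (auto simp: direct_sum_set_def)
      then have "w \<in> ?W" by (auto simp: coord_space_def split: sum.splits)
      then have "f (g w) = w" by (rule fg)
      moreover have "P (g w)" using w PQ[of "g w"] \<open>f (g w) = w\<close> by simp
      ultimately show "w \<in> f ` {x \<in> coord_space ?I. P x}"
        using gI[of w] by (metis (mono_tags, lifting) imageI mem_Collect_eq)
    qed
  qed
  have img_diff: "f ` diff_hyperplane ?I (\<sigma> i) (\<sigma> j) c =
      direct_sum_set (diff_hyperplane ?V i j c) (coord_space {()})" if "i \<in> ?V" "j \<in> ?V" for i j c
    unfolding diff_hyperplane_def by (rule img) (use that in \<open>auto simp: f_def\<close>)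
  have img_coord: "f ` diff_hyperplane ?I 1 (\<sigma> i) (- c) =
      direct_sum_set (coord_hyperplane ?V i c) (coord_space {()})" if "i \<in> ?V" for i c
    unfolding diff_hyperplane_def coord_hyperplane_def
    by (rule img) (use that in \<open>auto simp: f_def\<close>)
  have "(\<lambda>H. f ` H) ` hyperplanes (shi_ish (n + 1) (k + 1)) =
      {direct_sum_set H (coord_space {()}) | H. H \<in> hyperplanes (digraph_arrangement (T_digraph n k, T_weight n k))}"
  proof -
    have arcs: "i \<in> ?V \<and> j \<in> ?V" if "(i, j) \<in> parcs (T_digraph n k)" for i j
      using that assms by (auto simp: T_digraph_def)
    have V: "pverts (T_digraph n k) = ?V" by (simp add: T_digraph_def)
    show ?thesis
      unfolding hyperplanes_shi_ish_index[OF assms] \<sigma>_def[symmetric]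
        digraph_arrangement_def Let_def arrangement.simps fst_conv snd_conv V
        setcompr_eq_image Collect_mem_eq image_Un
      by (intro arg_cong2[where f = "(\<union>)"] image_Collect2_cong)
        (use img_diff img_coord arcs in blast)+
  qed
  moreover have "bij_betw f (coord_space ?I) ?W"
    by (rule bij_betw_byWitness[where f' = g]) (use gf fg gI fW in auto)
  moreover have "affine_map_on S f" for S
    unfolding affine_map_on_def
  proof (intro ballI allI impI ext)
    fix x y :: "nat \<Rightarrow> real" and s t :: real and w assume "s + t = 1"
    show "f (fun_scale s x + fun_scale t y) w = (fun_scale s (f x) + fun_scale t (f y)) w"
      by (auto simp: f_def fun_scale_def algebra_simps split: sum.splits)
  qed
  moreover have "index_set (shi_ish (n + 1) (k + 1)) = ?I"
    by (simp add: shi_ish_def Let_def)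
  moreover have "index_set (digraph_arrangement (T_digraph n k, T_weight n k)) = ?V"
    by (simp add: digraph_arrangement_def Let_def T_digraph_def)
  ultimately show ?thesis
    unfolding affinely_equivalent_def by (intro exI[of _ f]) (simp add: arr_prod_def Phi1_def)
qed

section \<open>Coking eliminations between consecutive digraphs\<close>

lemma coking_T_digraph:
  assumes "1 \<le> k" "k \<le> n - 1"
  shows "coking (pair_induce_subgraph (T_digraph n k) {1..n - k + 1}) (n - k + 1)"
  using assms by (auto simp: coking_def pair_induce_subgraph_def T_digraph_def)

text \<open>For \<open>i < v\<close> we have \<open>n - i + 1 > k\<close>, so the lower end drops
  from \<open>- k\<close> to \<open>- (k + 1)\<close>. At \<open>i = v\<close> the minimum is
  \<open>n - v + 1 = k\<close> both times. Deleting the arcs into \<open>v\<close> lowers the bound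
  on arc heads from \<open>v\<close> to \<open>v - 1\<close>.\<close>

lemma coking_elimination_T_digraph:
  assumes "1 \<le> k" "k \<le> n - 1" "v = n - k + 1"
  shows "coking_elimination v
      (pair_induce_subgraph (T_digraph n k) {1..v}, restrict (T_weight n k) {1..v}) =
    (pair_induce_subgraph (T_digraph n (k + 1)) {1..v}, restrict (T_weight n (k + 1)) {1..v})"
  using assms
  by (auto simp: coking_elimination_def pair_induce_subgraph_def T_digraph_def T_weight_def
      fun_eq_iff restrict_def min_def of_nat_diff)

lemma isolated_vertex_T_digraph:
  "n - k + 1 < i \<Longrightarrow> i \<le> n \<Longrightarrow> isolated_vertex (T_digraph n k) i"
  by (auto simp: isolated_vertex_def T_digraph_def)

lemma T_weight_Suc:
  "n - k + 1 < i \<Longrightarrow> i \<le> n \<Longrightarrow> T_weight n (Suc k) i = T_weight n k i"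
  by (auto simp: T_weight_def)

lemma coking_elimination_step_T_digraph:
  assumes "1 \<le> k" "k < n"
  shows "coking_elimination_step (T_digraph n k, T_weight n k) (T_digraph n (k + 1), T_weight n (k + 1))"
  unfolding coking_elimination_step_def
proof (intro conjI exI[of _ "{1..n - k + 1}"] exI[of _ "n - k + 1"] ballI)
  show "{1..n - k + 1} \<subseteq> pverts (fst (T_digraph n k, T_weight n k))"
    using assms by (auto simp: T_digraph_def)
  show "coking (fst (weighted_induce (T_digraph n k, T_weight n k) {1..n - k + 1})) (n - k + 1)"
    using coking_T_digraph[of k n] assms by (simp add: weighted_induce_def)
  show "coking_elimination (n - k + 1) (weighted_induce (T_digraph n k, T_weight n k) {1..n - k + 1}) =
      weighted_induce (T_digraph n (k + 1), T_weight n (k + 1)) {1..n - k + 1}"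
    using coking_elimination_T_digraph[of k n "n - k + 1"] assms by (simp add: weighted_induce_def)
qed (use assms in \<open>auto simp: T_digraph_def T_weight_Suc isolated_vertex_def\<close>)

theorem theorem3p13:
  shows
    "(\<forall>n k v :: nat. 1 \<le> n \<and> 1 \<le> k \<and> k \<le> n - 1 \<and> v = n - k + 1 \<longrightarrow>
        coking (pair_induce_subgraph (T_digraph n k) {1..v}) v \<and>
        coking_elimination v
            (pair_induce_subgraph (T_digraph n k) {1..v}, restrict (T_weight n k) {1..v}) =
          (pair_induce_subgraph (T_digraph n (k + 1)) {1..v},
           restrict (T_weight n (k + 1)) {1..v}) \<and>
        (\<forall>i \<in> {v + 1..n}.
           isolated_vertex (T_digraph n k) i \<and> isolated_vertex (T_digraph n (k + 1)) i \<and>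
           T_weight n k i = T_weight n (k + 1) i)) \<and>
     (\<forall>n k :: nat. 1 \<le> k \<and> k \<le> n \<longrightarrow>
        affinely_equivalent (shi_ish (n + 1) (k + 1))
          (arr_prod (digraph_arrangement (T_digraph n k, T_weight n k)) Phi1)) \<and>
     (\<forall>n :: nat. 1 \<le> n \<longrightarrow>
        (\<exists>D :: nat \<Rightarrow> nat weighted_digraph.
           (\<forall>k \<in> {1..n}. affinely_equivalent (shi_ish (n + 1) (k + 1))
              (arr_prod (digraph_arrangement (D k)) Phi1)) \<and>
           (\<forall>k \<in> {1..<n}. coking_elimination_step (D k) (D (k + 1))))) \<and>
     (\<forall>l k :: nat. 2 \<le> l \<and> 2 \<le> k \<and> k \<le> l \<longrightarrow>
        char_poly_arr (shi_ish l k) = [:0, 1:] * [:- int l, 1:] ^ (l - 1))"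
proof (intro conjI allI impI)
  fix n k v :: nat assume *: "1 \<le> n \<and> 1 \<le> k \<and> k \<le> n - 1 \<and> v = n - k + 1"
  then show "coking (pair_induce_subgraph (T_digraph n k) {1..v}) v"
    using coking_T_digraph by blast
  from * show "coking_elimination v
      (pair_induce_subgraph (T_digraph n k) {1..v}, restrict (T_weight n k) {1..v}) =
    (pair_induce_subgraph (T_digraph n (k + 1)) {1..v}, restrict (T_weight n (k + 1)) {1..v})"
    by (intro coking_elimination_T_digraph) auto
  from * show "\<forall>i \<in> {v + 1..n}.
      isolated_vertex (T_digraph n k) i \<and> isolated_vertex (T_digraph n (k + 1)) i \<and>
      T_weight n k i = T_weight n (k + 1) i"
    by (auto simp: T_weight_Suc intro!: isolated_vertex_T_digraph)
next
  fix n :: nat assume "1 \<le> n"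
  show "\<exists>D :: nat \<Rightarrow> nat weighted_digraph.
      (\<forall>k \<in> {1..n}. affinely_equivalent (shi_ish (n + 1) (k + 1))
         (arr_prod (digraph_arrangement (D k)) Phi1)) \<and>
      (\<forall>k \<in> {1..<n}. coking_elimination_step (D k) (D (k + 1)))"
    by (rule exI[of _ "\<lambda>k. (T_digraph n k, T_weight n k)"])
      (use affinely_equivalent_shi_ish coking_elimination_step_T_digraph in auto)
qed (use affinely_equivalent_shi_ish char_poly_shi_ish in auto)

end
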